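(* Let $p>0$ and $q>0$ be constants. Suppose that the following four conditions hold, with all constants independent of the step size $\Delta$ and of the initial data. (i) For each step size $\Delta$ there is a continuous numerical solution $\{X(t;0,\xi)\}_{t\ge-\tau}$ approximating the solution of the SDDE, and its segment process $\{X_{t_k}^{0,\xi}\}_{k\in\mathbb N}$ is a time-homogeneous Markov process. (ii) There are positive constants $K_1,K_2,K_3$ such that for all $t\ge0$ and all initial data $\xi$, $\mathbb E\|x_t^{0,\xi}\|^p\le K_1\mathbb E\|\xi\|^pe^{-K_2t}+K_3$. (iii) There are positive constants $K_4,K_5$ such that for every compact subset $K\subset C$, all $K$-valued initial data $\xi,\eta$ and all $t\ge0$, $\mathbb E\big(\|x_t^{0,\xi}-x_t^{0,\eta}\|^p\big)\le K_4\,\mathbb E\big(\|\xi-\eta\|^p\big)e^{-K_5t}$. (iv) For all grid times $0\le T_1<T_2$ there is a constant $C_{T_2-T_1}$, depending on $T_1,T_2$ only through $T_2-T_1$, such that $$\sup_{T_1\le t_k\le T_2}\mathbb E\Big(\big\|x_{t_k}^{T_1,X_{T_1}^{0,\xi}}-X_{t_k}^{T_1,X_{T_1}^{0,\xi}}\big\|^p\Big)\le C_{T_2-T_1}\Big(1+\sup_{T_1-\tau\le t_k\le T_1}\mathbb E\|X_{t_k}^{0,\xi}\|^p\Big)\Delta^q,$$ where by convention $\sup_{-\tau\le t_k\le0}\mathbb E\|X_{t_k}^{0,\xi}\|^p:=\mathbb E\|\xi\|^p$ (terms with $t_k\le 0$ are read as $\mathbb E\|\xi\|^p$). Let $\pi$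 be the (unique) invariant measure of the segment process $\{x_t\}_{t\ge0}$. Then for every bounded $\mathcal F_0$-measurable $C$-valued $\xi$, $$\lim_{t_k\to\infty,\ \Delta\to0}d_{\mathbb L}\big(\overline{\mathbb P}_{t_k}(\xi,\cdot),\pi(\cdot)\big)=0,$$ that is, for every $\epsilon>0$ there are $T>0$ and $\Delta^*>0$ such that $d_{\mathbb L}\big(\overline{\mathbb P}_{t_k}(\xi,\cdot),\pi(\cdot)\big)\le\epsilon$ for all step sizes $\Delta\in(0,\Delta^* )$ and all $k$ with $t_k=k\Delta\ge T$.
   Context: Let $\tau>0$, $d,m\in\mathbb N_+$; $|\cdot|$ is the Euclidean norm on $\mathbb R^d$ (trace norm on $\mathbb R^{d\times m}$); $C=C([-\tau,0];\mathbb R^d)$ is the space of continuous functions with norm $\|X\|=\sup_{-\tau\le\theta\le0}|X(\theta)|$. $W$ is an $m$-dimensional Brownian motion on a probability space with right-continuous complete filtration $\{\mathcal F_t\}_{t\ge0}$. The stochastic delay differential equation (SDDE) is $$dx(t)=f(x(t),x(t-\tau))\,dt+g(x(t),x(t-\tau))\,dW(t),\quad t>0,\qquad x(\theta)=\xi(\theta),\ \theta\in[-\tau,0],$$ with $f:\mathbb R^d\times\mathbb R^d\to\mathbb R^d$ and $g:\mathbb R^d\times\mathbb R^d\to\mathbb R^{d\times m}$ Borel measurable; it is assumed to have a unique global solution. For $s\ge0$ and an $\mathcal F_s$-measurable $C$-valued random variable $\eta$, $x(t;s,\eta)$, $t\ge s-\tau$, is the solution started at time $s$ from $\eta$, i.e.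 $x(s+\theta;s,\eta)=\eta(\theta)$ for $\theta\in[-\tau,0]$, and $x_t^{s,\eta}(\theta)=x(t+\theta;s,\eta)$ is its segment process. The segment process is a homogeneous Markov process. Initial data are random, $C$-valued, and measurable with respect to the $\sigma$-algebra at the starting time; since the equation is autonomous, a solution started at time $s$ from an $\mathcal F_s$-measurable segment $\eta$ is regarded as a solution $x(\cdot;0,\eta)$ started at time $0$ (with shifted Brownian motion and filtration), and hypotheses on solutions started at time $0$ apply to such initial data. Step sizes are $\Delta=\tau/M$ with $M\in\mathbb N_+$; $t_k=k\Delta$ for $k\ge-M$; a grid time is an integer multiple of $\Delta$. A continuous numerical solution (for step size $\Delta$) is a continuous-in-time process $X(t;s,\eta)$, $t\ge s-\tau$, defined for starting grid times $s\ge0$ and $\mathcal F_s$-measurable $C$-valued $\eta$, with $X(s+\theta;s,\eta)=\eta(\theta)$ for $\theta\in[-\tau,0]$. Its segment is $X_t^{s,\eta}(\theta)=X(t+\theta;s,\eta)$, $\theta\in[-\tau,0]$. It has the flow property $X(t;0,\xi)=X(t;s,X_s^{0,\xi})$ for $0\le s<t$ with $s$ a grid time; segments at grid times $s$ are $\mathcal F_s$-measurable. $\mathcal P(C)$ is the set of Borel probability measures on $C$. $\mathbb P_t(\xi,\cdot)$ denotes the law of $x_t^{0,\xi}$ and $\overline{\mathbb P}_{t_k}(\xi,\cdot)$ the law of $X_{t_k}^{0,\xi}$. Let $\mathbb L$ be the set of $F:C\to\mathbb R$ with $|F(x)-F(y)|\le\|x-y\|$ for all $x,y\in C$ and $\sup_{x\in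 C}|F(x)|\le1$, and $d_{\mathbb L}(\mathbb P_1,\mathbb P_2)=\sup_{F\in\mathbb L}\big|\int_CF\,d\mathbb P_1-\int_CF\,d\mathbb P_2\big|$. A measure $\pi\in\mathcal P(C)$ is an invariant measure of $\{x_t\}$ if $\lim_{t\to\infty}d_{\mathbb L}(\mathbb P_t(\xi,\cdot),\pi)=0$ for every $\xi\in C$. It is known that under conditions (ii) and (iii) the segment process has a unique invariant measure. *)

theory Defs
  imports "HOL-Probability.Probability"
begin

subsection \<open>The space of segments\<close>

text \<open>
  \<open>C([-\<tau>,0]; R^d)\<close> is represented by the bounded continuous functions on the real line that are
  constant to the left of \<open>-\<tau>\<close> and to the right of \<open>0\<close>.  Extending a continuous function on
  \<open>[-\<tau>,0]\<close> by its boundary values identifies the two spaces, and the supremum norm of the type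
  \<open>\<Rightarrow>\<^sub>C\<close> becomes the supremum norm over \<open>[-\<tau>,0]\<close> (lemma \<open>norm_segs\<close>).
\<close>

definition segs :: "real \<Rightarrow> (real \<Rightarrow>\<^sub>C 'a::real_normed_vector) set" where
  "segs \<tau> = {\<phi>. ext_cont (apply_bcontfun \<phi>) (-\<tau>) 0 = apply_bcontfun \<phi>}"

definition borel_segs :: "real \<Rightarrow> (real \<Rightarrow>\<^sub>C 'a::real_normed_vector) measure" where
  "borel_segs \<tau> = restrict_space borel (segs \<tau>)"

definition segment ::
    "real \<Rightarrow> (real \<Rightarrow> 'w \<Rightarrow> 'a) \<Rightarrow> real \<Rightarrow> 'w \<Rightarrow> (real \<Rightarrow>\<^sub>C 'a::real_normed_vector)" where
  "segment \<tau> z t \<omega> = Bcontfun (ext_cont (\<lambda>\<theta>. z (t + \<theta>) \<omega>) (-\<tau>) 0)"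

lemma clamp_in_real_interval: "0 < \<tau> \<Longrightarrow> clamp (-\<tau>) 0 (x::real) \<in> {-\<tau>..0}"
  using clamp_in_interval[of "-\<tau>" 0 x] by (simp add: box_real)

lemma norm_segs:
  assumes "0 < \<tau>" and "\<phi> \<in> segs \<tau>"
  shows "norm \<phi> = (SUP \<theta>\<in>{-\<tau>..0}. norm (apply_bcontfun \<phi> \<theta>))"
proof -
  have eq: "apply_bcontfun \<phi> x = apply_bcontfun \<phi> (clamp (-\<tau>) 0 x)" for x
    using assms(2) unfolding segs_def ext_cont_def by (metis (mono_tags, lifting) mem_Collect_eq)
  have "range (\<lambda>x. norm (apply_bcontfun \<phi> x)) = (\<lambda>x. norm (apply_bcontfun \<phi> x)) ` {-\<tau>..0}"
  proof (intro equalityI subsetI)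
    fix r assume "r \<in> range (\<lambda>x. norm (apply_bcontfun \<phi> x))"
    then obtain x where "r = norm (apply_bcontfun \<phi> (clamp (-\<tau>) 0 x))"
      using eq by (metis rangeE)
    then show "r \<in> (\<lambda>x. norm (apply_bcontfun \<phi> x)) ` {-\<tau>..0}"
      using clamp_in_real_interval[OF assms(1)] by blast
  qed blast
  then show ?thesis
    by (simp add: norm_bcontfun_def dist_bcontfun.rep_eq)
qed

lemma segment_apply:
  assumes "0 < \<tau>" and "continuous_on {t - \<tau>..t} (\<lambda>u. z u \<omega>)"
  shows "apply_bcontfun (segment \<tau> z t \<omega>) = ext_cont (\<lambda>\<theta>. z (t + \<theta>) \<omega>) (-\<tau>) 0"
    and "segment \<tau> z t \<omega> \<in> segs \<tau>"
proof -
  have c: "continuous_on (cbox (-\<tau>) 0) (\<lambda>\<theta>. z (t + \<theta>) \<omega>)"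
    by (rule continuous_on_compose2[OF assms(2)]) (auto intro!: continuous_intros)
  have "continuous_on UNIV (ext_cont (\<lambda>\<theta>. z (t + \<theta>) \<omega>) (-\<tau>) 0)"
    unfolding ext_cont_def by (rule clamp_continuous_on[OF c])
  moreover have "bounded (range (ext_cont (\<lambda>\<theta>. z (t + \<theta>) \<omega>) (-\<tau>) 0))"
    unfolding ext_cont_def
    by (rule clamp_bounded[OF compact_imp_bounded[OF compact_continuous_image[OF c compact_cbox]]])
  ultimately have "ext_cont (\<lambda>\<theta>. z (t + \<theta>) \<omega>) (-\<tau>) 0 \<in> bcontfun"
    by (simp add: bcontfun_def)
  then show *: "apply_bcontfun (segment \<tau> z t \<omega>) = ext_cont (\<lambda>\<theta>. z (t + \<theta>) \<omega>) (-\<tau>) 0"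
    unfolding segment_def by (rule Bcontfun_inverse)
  have "clamp (-\<tau>) 0 (clamp (-\<tau>) 0 x) = clamp (-\<tau>) 0 x" for x :: real
    using clamp_in_real_interval[OF assms(1), of x] by (intro clamp_cancel_cbox) (simp add: box_real)
  then show "segment \<tau> z t \<omega> \<in> segs \<tau>"
    by (simp add: segs_def * ext_cont_def fun_eq_iff)
qed

definition moment :: "'w measure \<Rightarrow> real \<Rightarrow> ('w \<Rightarrow> 'b::real_normed_vector) \<Rightarrow> ennreal" where
  "moment M p Z = (\<integral>\<^sup>+ \<omega>. ennreal (norm (Z \<omega>) powr p) \<partial>M)"


subsection \<open>Filtration, Brownian motion, stochastic integral\<close>

text \<open>Time is \<open>[0,\<infinity>)\<close>; \<open>F t\<close> and \<open>W t\<close> are irrelevant for \<open>t < 0\<close>.\<close>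

definition usual_filtration :: "'w measure \<Rightarrow> (real \<Rightarrow> 'w measure) \<Rightarrow> bool" where
  "usual_filtration M F \<longleftrightarrow>
     (\<forall>t\<ge>0. subalgebra M (F t)) \<and>
     (\<forall>s t. 0 \<le> s \<and> s \<le> t \<longrightarrow> sets (F s) \<subseteq> sets (F t)) \<and>
     (\<forall>t\<ge>0. sets (F t) = (\<Inter>u\<in>{t<..}. sets (F u))) \<and>
     (\<forall>N\<in>null_sets M. \<forall>A\<subseteq>N. A \<in> sets (F 0))"

definition brownian_motion ::
    "'w measure \<Rightarrow> (real \<Rightarrow> 'w measure) \<Rightarrow> (real \<Rightarrow> 'w \<Rightarrow> real^'m) \<Rightarrow> bool" where
  "brownian_motion M F W \<longleftrightarrow>
     (\<forall>t\<ge>0. W t \<in> borel_measurable (F t)) \<and>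
     (AE \<omega> in M. W 0 \<omega> = 0) \<and>
     (\<forall>\<omega>\<in>space M. continuous_on {0..} (\<lambda>t. W t \<omega>)) \<and>
     (\<forall>s t. 0 \<le> s \<and> s < t \<longrightarrow>
        prob_space.indep_set M (sets (F s))
          (sets (vimage_algebra (space M) (\<lambda>\<omega>. W t \<omega> - W s \<omega>) borel)) \<and>
        distributed M lborel (\<lambda>\<omega>. W t \<omega> - W s \<omega>)
          (\<lambda>y. ennreal (\<Prod>i\<in>UNIV. normal_density 0 (sqrt (t - s)) (y $ i))))"

definition tends_to_0_in_prob :: "'w measure \<Rightarrow> (nat \<Rightarrow> 'w \<Rightarrow> ennreal) \<Rightarrow> bool" where
  "tends_to_0_in_prob M Z \<longleftrightarrow>
     (\<forall>\<epsilon>>0. (\<lambda>n. measure M {\<omega>\<in>space M. ennreal \<epsilon> < Z n \<omega>}) \<longlonglongrightarrow> 0)"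

text \<open>
  A simple process on \<open>[s,\<infinity>)\<close> is the sum over \<open>i < N\<close> of \<open>1_{(r i, r (i+1)]} A i\<close>, with bounded
  \<open>F (r i)\<close>-measurable \<open>A i\<close>.
\<close>

definition simple_data ::
    "'w measure \<Rightarrow> (real \<Rightarrow> 'w measure) \<Rightarrow> real \<Rightarrow> nat \<Rightarrow> (nat \<Rightarrow> real) \<Rightarrow>
      (nat \<Rightarrow> 'w \<Rightarrow> real^'m^'d) \<Rightarrow> bool" where
  "simple_data M F s N r A \<longleftrightarrow>
     s \<le> r 0 \<and>
     (\<forall>i<N. r i \<le> r (Suc i) \<and> A i \<in> borel_measurable (F (r i)) \<and>
        (\<exists>B. \<forall>\<omega>\<in>space M. norm (A i \<omega>) \<le> B))"

definition simple_process ::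
    "nat \<Rightarrow> (nat \<Rightarrow> real) \<Rightarrow> (nat \<Rightarrow> 'w \<Rightarrow> real^'m^'d) \<Rightarrow> real \<Rightarrow> 'w \<Rightarrow> real^'m^'d" where
  "simple_process N r A u \<omega> = (\<Sum>i<N. indicator {r i<..r (Suc i)} u *\<^sub>R A i \<omega>)"

definition simple_integral ::
    "(real \<Rightarrow> 'w \<Rightarrow> real^'m) \<Rightarrow> nat \<Rightarrow> (nat \<Rightarrow> real) \<Rightarrow> (nat \<Rightarrow> 'w \<Rightarrow> real^'m^'d) \<Rightarrow>
      real \<Rightarrow> 'w \<Rightarrow> real^'d" where
  "simple_integral W N r A t \<omega> =
     (\<Sum>i<N. A i \<omega> *v (W (min t (r (Suc i))) \<omega> - W (min t (r i)) \<omega>))"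

text \<open>
  \<open>is_ito_integral M F W s H Y\<close>: \<open>Y\<close> is a continuous adapted version of \<open>t \<mapsto> \<integral>_s^t H dW\<close>, \<open>t \<ge> s\<close>,
  the limit in probability of integrals of simple processes that approximate \<open>H\<close> in the sense
  that \<open>\<integral>_s^t |H_n - H|^2 du \<rightarrow> 0\<close> in probability.  The norm on \<open>real^'m^'d\<close> is the trace
  (Frobenius) norm.
\<close>

definition is_ito_integral ::
    "'w measure \<Rightarrow> (real \<Rightarrow> 'w measure) \<Rightarrow> (real \<Rightarrow> 'w \<Rightarrow> real^'m) \<Rightarrow> real \<Rightarrow>
      (real \<Rightarrow> 'w \<Rightarrow> real^'m^'d) \<Rightarrow> (real \<Rightarrow> 'w \<Rightarrow> real^'d) \<Rightarrow> bool" where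
  "is_ito_integral M F W s H Y \<longleftrightarrow>
     (\<lambda>(u, \<omega>). indicator {s..} u *\<^sub>R H u \<omega>) \<in> borel_measurable (lborel \<Otimes>\<^sub>M M) \<and>
     (\<forall>t\<ge>s. H t \<in> borel_measurable (F t)) \<and>
     (AE \<omega> in M. \<forall>t\<ge>s. (\<integral>\<^sup>+ u\<in>{s..t}. ennreal ((norm (H u \<omega>))\<^sup>2) \<partial>lborel) < \<infinity>) \<and>
     (\<forall>t\<ge>s. Y t \<in> borel_measurable (F t)) \<and>
     (\<forall>\<omega>\<in>space M. continuous_on {s..} (\<lambda>t. Y t \<omega>)) \<and>
     (\<exists>N r A.
        (\<forall>n. simple_data M F s (N n) (r n) (A n)) \<and>
        (\<forall>t\<ge>s.
           tends_to_0_in_prob M (\<lambda>n \<omega>. \<integral>\<^sup>+ u\<in>{s..t}.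
             ennreal ((norm (simple_process (N n) (r n) (A n) u \<omega> - H u \<omega>))\<^sup>2) \<partial>lborel) \<and>
           tends_to_0_in_prob M (\<lambda>n \<omega>.
             ennreal (norm (simple_integral W (N n) (r n) (A n) t \<omega> - Y t \<omega>)))))"


subsection \<open>The stochastic delay differential equation\<close>

definition solves_sdde ::
    "'w measure \<Rightarrow> (real \<Rightarrow> 'w measure) \<Rightarrow> (real \<Rightarrow> 'w \<Rightarrow> real^'m) \<Rightarrow> real \<Rightarrow>
      (real^'d \<Rightarrow> real^'d \<Rightarrow> real^'d) \<Rightarrow> (real^'d \<Rightarrow> real^'d \<Rightarrow> real^'m^'d) \<Rightarrow>
      real \<Rightarrow> ('w \<Rightarrow> (real \<Rightarrow>\<^sub>C (real^'d))) \<Rightarrow> (real \<Rightarrow> 'w \<Rightarrow> real^'d) \<Rightarrow> bool" where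
  "solves_sdde M F W \<tau> f g s \<eta> z \<longleftrightarrow>
     (\<forall>\<omega>\<in>space M. continuous_on {s - \<tau>..} (\<lambda>t. z t \<omega>)) \<and>
     (\<forall>t\<ge>s. z t \<in> borel_measurable (F t)) \<and>
     (\<forall>\<omega>\<in>space M. \<forall>\<theta>\<in>{-\<tau>..0}. z (s + \<theta>) \<omega> = apply_bcontfun (\<eta> \<omega>) \<theta>) \<and>
     (AE \<omega> in M. \<forall>t\<ge>s. set_integrable lborel {s..t} (\<lambda>u. f (z u \<omega>) (z (u - \<tau>) \<omega>))) \<and>
     (\<exists>Y. is_ito_integral M F W s (\<lambda>u \<omega>. g (z u \<omega>) (z (u - \<tau>) \<omega>)) Y \<and>
        (AE \<omega> in M. \<forall>t\<ge>s.
           z t \<omega> = z s \<omega> + (LINT u:{s..t}|lborel. f (z u \<omega>) (z (u - \<tau>) \<omega>)) + Y t \<omega>))"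

text \<open>
  \<open>x s \<eta> t \<omega>\<close> stands for \<open>x(t; s, \<eta>)(\<omega>)\<close>.  The solution from every starting time \<open>s \<ge> 0\<close> and every
  \<open>F s\<close>-measurable segment-valued \<open>\<eta>\<close> exists globally and is unique up to indistinguishability.
\<close>

definition unique_global_solution ::
    "'w measure \<Rightarrow> (real \<Rightarrow> 'w measure) \<Rightarrow> (real \<Rightarrow> 'w \<Rightarrow> real^'m) \<Rightarrow> real \<Rightarrow>
      (real^'d \<Rightarrow> real^'d \<Rightarrow> real^'d) \<Rightarrow> (real^'d \<Rightarrow> real^'d \<Rightarrow> real^'m^'d) \<Rightarrow>
      (real \<Rightarrow> ('w \<Rightarrow> (real \<Rightarrow>\<^sub>C (real^'d))) \<Rightarrow> real \<Rightarrow> 'w \<Rightarrow> real^'d) \<Rightarrow> bool" where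
  "unique_global_solution M F W \<tau> f g x \<longleftrightarrow>
     (\<forall>s\<ge>0. \<forall>\<eta> \<in> F s \<rightarrow>\<^sub>M borel_segs \<tau>.
        solves_sdde M F W \<tau> f g s \<eta> (x s \<eta>) \<and>
        (\<forall>z. solves_sdde M F W \<tau> f g s \<eta> z \<longrightarrow>
           (AE \<omega> in M. \<forall>t\<ge>s - \<tau>. z t \<omega> = x s \<eta> t \<omega>)))"


subsection \<open>Markov processes, laws and invariant measures\<close>

text \<open>
  \<open>Z\<close>, with time set \<open>I\<close> and state space \<open>S\<close>, is a time-homogeneous Markov process with respect to
  \<open>F\<close>, with transition probabilities \<open>P h y\<close> over time lag \<open>h\<close> from state \<open>y\<close>.
\<close>

definition homogeneous_markov ::
    "'w measure \<Rightarrow> (real \<Rightarrow> 'w measure) \<Rightarrow> 's measure \<Rightarrow> real set \<Rightarrow>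
      (real \<Rightarrow> 'w \<Rightarrow> 's) \<Rightarrow> (real \<Rightarrow> 's \<Rightarrow> 's measure) \<Rightarrow> bool" where
  "homogeneous_markov M F S I Z P \<longleftrightarrow>
     (\<forall>u\<in>I. Z u \<in> F u \<rightarrow>\<^sub>M S) \<and>
     (\<forall>u\<in>I. \<forall>v\<in>I. u \<le> v \<longrightarrow>
        P (v - u) \<in> S \<rightarrow>\<^sub>M prob_algebra S \<and>
        (\<forall>A\<in>sets S. AE \<omega> in M.
           real_cond_exp M (F u) (\<lambda>\<omega>'. indicator A (Z v \<omega>')) \<omega> = measure (P (v - u) (Z u \<omega>)) A))"

text \<open>
  \<open>segment_law M \<tau> (x 0) \<xi> t\<close> is the law of the segment at time \<open>t\<close> of \<open>x(\<cdot>; 0, \<xi>)\<close>, and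
  \<open>segment_kernel\<close> is its special case of a deterministic initial segment.
\<close>

definition segment_law ::
    "'w measure \<Rightarrow> real \<Rightarrow> (('w \<Rightarrow> (real \<Rightarrow>\<^sub>C 'a)) \<Rightarrow> real \<Rightarrow> 'w \<Rightarrow> 'a) \<Rightarrow>
      ('w \<Rightarrow> (real \<Rightarrow>\<^sub>C 'a)) \<Rightarrow> real \<Rightarrow> (real \<Rightarrow>\<^sub>C 'a::real_normed_vector) measure" where
  "segment_law M \<tau> x0 \<xi> t = distr M (borel_segs \<tau>) (segment \<tau> (x0 \<xi>) t)"

definition segment_kernel ::
    "'w measure \<Rightarrow> real \<Rightarrow> (('w \<Rightarrow> (real \<Rightarrow>\<^sub>C 'a)) \<Rightarrow> real \<Rightarrow> 'w \<Rightarrow> 'a) \<Rightarrow>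
      real \<Rightarrow> (real \<Rightarrow>\<^sub>C 'a) \<Rightarrow> (real \<Rightarrow>\<^sub>C 'a::real_normed_vector) measure" where
  "segment_kernel M \<tau> x0 t y = segment_law M \<tau> x0 (\<lambda>_. y) t"

definition test_functions :: "real \<Rightarrow> ((real \<Rightarrow>\<^sub>C 'a::real_normed_vector) \<Rightarrow> real) set" where
  "test_functions \<tau> =
     {G. (\<forall>\<phi>\<in>segs \<tau>. \<forall>\<psi>\<in>segs \<tau>. \<bar>G \<phi> - G \<psi>\<bar> \<le> norm (\<phi> - \<psi>)) \<and> (\<forall>\<phi>\<in>segs \<tau>. \<bar>G \<phi>\<bar> \<le> 1)}"

definition dist_L ::
    "real \<Rightarrow> (real \<Rightarrow>\<^sub>C 'a::real_normed_vector) measure \<Rightarrow> (real \<Rightarrow>\<^sub>C 'a) measure \<Rightarrow> real" where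
  "dist_L \<tau> P Q = (SUP G\<in>test_functions \<tau>. \<bar>(\<integral>\<phi>. G \<phi> \<partial>P) - (\<integral>\<phi>. G \<phi> \<partial>Q)\<bar>)"

definition invariant_measure ::
    "'w measure \<Rightarrow> real \<Rightarrow> (('w \<Rightarrow> (real \<Rightarrow>\<^sub>C 'a)) \<Rightarrow> real \<Rightarrow> 'w \<Rightarrow> 'a) \<Rightarrow>
      (real \<Rightarrow>\<^sub>C 'a::real_normed_vector) measure \<Rightarrow> bool" where
  "invariant_measure M \<tau> x0 \<pi> \<longleftrightarrow>
     prob_space \<pi> \<and> sets \<pi> = sets (borel_segs \<tau>) \<and>
     (\<forall>y\<in>segs \<tau>. ((\<lambda>t. dist_L \<tau> (segment_kernel M \<tau> x0 t y) \<pi>) \<longlongrightarrow> 0) at_top)"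


subsection \<open>Numerical solutions\<close>

definition step_sizes :: "real \<Rightarrow> real set" where
  "step_sizes \<tau> = {\<tau> / real n | n. 0 < n}"

definition grid :: "real \<Rightarrow> real set" where
  "grid \<Delta> = {of_int k * \<Delta> | k. True}"

text \<open>
  \<open>X s \<eta> t \<omega>\<close> stands for \<open>X(t; s, \<eta>)(\<omega>)\<close>, for one fixed step size \<open>\<Delta>\<close>.
\<close>

definition numerical_solution ::
    "'w measure \<Rightarrow> (real \<Rightarrow> 'w measure) \<Rightarrow> real \<Rightarrow> real \<Rightarrow>
      (real \<Rightarrow> ('w \<Rightarrow> (real \<Rightarrow>\<^sub>C 'a)) \<Rightarrow> real \<Rightarrow> 'w \<Rightarrow> 'a::real_normed_vector) \<Rightarrow> bool" where
  "numerical_solution M F \<tau> \<Delta> X \<longleftrightarrow>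
     (\<forall>s\<in>grid \<Delta>. 0 \<le> s \<longrightarrow> (\<forall>\<eta> \<in> F s \<rightarrow>\<^sub>M borel_segs \<tau>.
        (\<forall>\<omega>\<in>space M. continuous_on {s - \<tau>..} (\<lambda>t. X s \<eta> t \<omega>)) \<and>
        (\<forall>\<omega>\<in>space M. \<forall>\<theta>\<in>{-\<tau>..0}. X s \<eta> (s + \<theta>) \<omega> = apply_bcontfun (\<eta> \<omega>) \<theta>) \<and>
        (\<forall>u\<in>grid \<Delta>. s \<le> u \<longrightarrow> segment \<tau> (X s \<eta>) u \<in> F u \<rightarrow>\<^sub>M borel_segs \<tau>))) \<and>
     (\<forall>\<xi> \<in> F 0 \<rightarrow>\<^sub>M borel_segs \<tau>. \<forall>s\<in>grid \<Delta>. 0 \<le> s \<longrightarrow>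
        (AE \<omega> in M. \<forall>t>s. X 0 \<xi> t \<omega> = X s (segment \<tau> (X 0 \<xi>) s) t \<omega>))"

end

theory Submission
  imports Defs "HOL-Real_Asymp.Real_Asymp"
begin

text \<open>
  Condition (ii) contracts \<open>p\<close>-th moments over a long time lag and (iv) makes the numerical error over
  that lag small, so for small steps the moments of the numerical segments are bounded by some \<open>R\<close>
  uniformly in time.  To compare \<open>X t\<close> with \<open>\<pi>\<close>, restart the exact solution at \<open>t - h\<close> from the
  numerical segment \<open>\<eta>\<close>.  By (iv) the restarted solution is close to \<open>X t\<close> for small steps.  By the
  Markov property its law at time \<open>t\<close> is the average over \<open>\<eta>\<close> of the transition probabilities
  \<open>P h y\<close>.  No tightness of \<open>\<eta>\<close> is needed: the constants in (iii) do not depend on the compact set,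
  so (iii) applied to \<open>{y, 0}\<close> bounds the distance of \<open>P h y\<close> from \<open>P h 0\<close> in terms of
  \<open>norm y powr p * exp (- K5 * h)\<close>, which averages to at most \<open>R * exp (- K5 * h)\<close>.
\<close>

section \<open>Moments and measurability of segment-valued random variables\<close>

lemma powr_add_le:
  fixes a b p :: real
  assumes "0 \<le> a" "0 \<le> b" "0 < p"
  shows "(a + b) powr p \<le> 2 powr p * (a powr p + b powr p)"
proof -
  \<comment> \<open>Comparison with the maximum, rather than convexity, covers \<open>p < 1\<close>
    as well.\<close>
  have "(a + b) powr p \<le> (2 * max a b) powr p"
    using assms by (intro powr_mono2) auto
  also have "\<dots> = 2 powr p * max a b powr p"
    using assms by (simp add: powr_mult)
  also have "max a b powr p \<le> a powr p + b powr p"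
    by (simp add: max_def)
  finally show ?thesis by simp
qed

text \<open>By continuity, a violation of the bound at one point persists on an open interval and
  hence at a rational. Countably many evaluations therefore decide the bound, which is what
  measurability of norms rests on.\<close>

lemma norm_bcontfun_le_iff:
  fixes \<phi> :: "real \<Rightarrow>\<^sub>C 'a::real_normed_vector"
  shows "norm \<phi> \<le> a \<longleftrightarrow> (\<forall>r\<in>\<rat>. norm (apply_bcontfun \<phi> r) \<le> a)"
proof
  assume r: "\<forall>r\<in>\<rat>. norm (apply_bcontfun \<phi> r) \<le> a"
  have "norm (apply_bcontfun \<phi> u) \<le> a" for u
  proof (rule ccontr)
    assume "\<not> ?thesis"
    then have u: "u \<in> {v. a < norm (apply_bcontfun \<phi> v)}" by simp
    have "open {v. a < norm (apply_bcontfun \<phi> v)}"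
      by (intro open_Collect_less continuous_intros) auto
    then obtain e where e: "e > 0" "\<And>v. dist v u < e \<Longrightarrow> a < norm (apply_bcontfun \<phi> v)"
      using u unfolding open_dist by blast
    obtain v where "v \<in> \<rat>" "u < v" "v < u + e"
      using Rats_dense_in_real[of u "u + e"] e(1) by auto
    then show False using e(2)[of v] r by (force simp: dist_real_def)
  qed
  then show "norm \<phi> \<le> a" by (rule norm_bound)
qed (auto intro: order_trans[OF norm_bounded])

lemma space_borel_segs [simp]: "space (borel_segs \<tau>) = segs \<tau>"
  by (simp add: borel_segs_def space_restrict_space)

lemma measurable_segs_into:
  "Y \<in> N \<rightarrow>\<^sub>M borel_segs \<tau> \<Longrightarrow> \<omega> \<in> space N \<Longrightarrow> Y \<omega> \<in> segs \<tau>"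
  by (metis measurable_space space_borel_segs)

text \<open>The type \<open>\<Rightarrow>\<^sub>C\<close> over the real line is not separable, so the difference of two measurable maps
  need not be measurable; its norm is, being a supremum over rational points.\<close>

lemma borel_measurable_norm_segs_diff:
  fixes Y Z :: "'w \<Rightarrow> (real \<Rightarrow>\<^sub>C 'a::{real_normed_vector, second_countable_topology})"
  assumes Y: "Y \<in> N \<rightarrow>\<^sub>M borel_segs \<tau>" and Z: "Z \<in> N \<rightarrow>\<^sub>M borel_segs \<tau>"
  shows "(\<lambda>\<omega>. norm (Y \<omega> - Z \<omega>)) \<in> borel_measurable N"
proof -
  have ev: "(\<lambda>\<omega>. apply_bcontfun (V \<omega>) r) \<in> borel_measurable N"
    if "V \<in> N \<rightarrow>\<^sub>M borel_segs \<tau>" for V :: "'w \<Rightarrow> (real \<Rightarrow>\<^sub>C 'a)" and r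
  proof -
    have "V \<in> borel_measurable N"
      using that by (simp add: borel_segs_def measurable_restrict_space2_iff)
    moreover have "continuous_on UNIV (\<lambda>\<phi>::real \<Rightarrow>\<^sub>C 'a. apply_bcontfun \<phi> r)"
      unfolding continuous_on_iff
      by (metis dist_bounded le_less_trans)
    ultimately show ?thesis
      by (rule measurable_compose[OF _ borel_measurable_continuous_onI])
  qed
  note [measurable] = ev[OF Y] ev[OF Z]
  show ?thesis
  proof (rule borel_measurableI_le)
    fix a
    have "{\<omega> \<in> space N. norm (Y \<omega> - Z \<omega>) \<le> a} =
      {\<omega> \<in> space N. \<forall>r\<in>\<rat>. norm (apply_bcontfun (Y \<omega>) r - apply_bcontfun (Z \<omega>) r) \<le> a}"
      by (simp add: norm_bcontfun_le_iff)
    also have "\<dots> \<in> sets N"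
      by (intro sets.sets_Collect_countable_All' countable_rat) auto
    finally show "{\<omega> \<in> space N. norm (Y \<omega> - Z \<omega>) \<le> a} \<in> sets N" .
  qed
qed

lemma zero_in_segs: "0 \<in> segs \<tau>"
  by (simp add: segs_def ext_cont_def fun_eq_iff)

lemma borel_measurable_norm_segs:
  fixes Y :: "'w \<Rightarrow> (real \<Rightarrow>\<^sub>C 'a::{real_normed_vector, second_countable_topology})"
  assumes "Y \<in> N \<rightarrow>\<^sub>M borel_segs \<tau>"
  shows "(\<lambda>\<omega>. norm (Y \<omega>)) \<in> borel_measurable N"
  using borel_measurable_norm_segs_diff[OF assms, of "\<lambda>_. 0"] by (simp add: zero_in_segs)

text \<open>Passes from the moments of the restarted exact solution to those of the numerical one.
  With extended nonnegative integrals no moment has to be finite beforehand.\<close>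

lemma moment_triangle:
  fixes Y Z :: "'w \<Rightarrow> (real \<Rightarrow>\<^sub>C 'a::{real_normed_vector, second_countable_topology})"
  assumes Y: "Y \<in> M \<rightarrow>\<^sub>M borel_segs \<tau>" and Z: "Z \<in> M \<rightarrow>\<^sub>M borel_segs \<tau>" and p: "0 < p"
  shows "moment M p Z \<le> ennreal (2 powr p) * (moment M p Y + moment M p (\<lambda>\<omega>. Y \<omega> - Z \<omega>))"
proof -
  note [measurable] = borel_measurable_norm_segs_diff[OF Y Z] borel_measurable_norm_segs[OF Y]
  have "norm (Z \<omega>) powr p \<le> 2 powr p * (norm (Y \<omega>) powr p + norm (Y \<omega> - Z \<omega>) powr p)" for \<omega>
  proof -
    have "norm (Z \<omega>) \<le> norm (Y \<omega>) + norm (Y \<omega> - Z \<omega>)"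
      using norm_triangle_sub[of "Z \<omega>" "Y \<omega>"] by (simp add: norm_minus_commute)
    then have "norm (Z \<omega>) powr p \<le> (norm (Y \<omega>) + norm (Y \<omega> - Z \<omega>)) powr p"
      using p by (intro powr_mono2) auto
    also have "\<dots> \<le> 2 powr p * (norm (Y \<omega>) powr p + norm (Y \<omega> - Z \<omega>) powr p)"
      using p by (intro powr_add_le) auto
    finally show ?thesis .
  qed
  then have "moment M p Z
    \<le> (\<integral>\<^sup>+\<omega>. ennreal (2 powr p) * (ennreal (norm (Y \<omega>) powr p) + ennreal (norm (Y \<omega> - Z \<omega>) powr p)) \<partial>M)"
    unfolding moment_def
    by (intro nn_integral_mono) (simp flip: ennreal_plus ennreal_mult add: ennreal_leI)
  also have "\<dots> = ennreal (2 powr p) * (moment M p Y + moment M p (\<lambda>\<omega>. Y \<omega> - Z \<omega>))"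
    unfolding moment_def by (subst nn_integral_cmult) (auto simp: nn_integral_add)
  finally show ?thesis .
qed

section \<open>Test functions and the metric \<open>dist_L\<close>\<close>

lemma test_function_measurable:
  fixes G :: "(real \<Rightarrow>\<^sub>C 'a::real_normed_vector) \<Rightarrow> real"
  assumes "G \<in> test_functions \<tau>"
  shows "G \<in> borel_measurable (borel_segs \<tau>)"
proof -
  \<comment> \<open>A test function is constrained only on \<open>segs \<tau>\<close>; continuity
    relative to that set suffices because \<open>borel_segs\<close> is the restricted Borel
    space.\<close>
  have "continuous_on (segs \<tau>) G"
    unfolding continuous_on_iff
  proof (intro ballI allI impI)
    fix \<phi> :: "real \<Rightarrow>\<^sub>C 'a" and e :: real
    assume "\<phi> \<in> segs \<tau>" "0 < e"
    moreover have "\<bar>G \<psi> - G \<phi>\<bar> \<le> norm (\<psi> - \<phi>)" if "\<psi> \<in> segs \<tau>" for \<psi>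
      using assms that \<open>\<phi> \<in> segs \<tau>\<close> by (simp add: test_functions_def)
    ultimately show "\<exists>d>0. \<forall>\<psi>\<in>segs \<tau>. dist \<psi> \<phi> < d \<longrightarrow> dist (G \<psi>) (G \<phi>) < e"
      unfolding dist_norm real_norm_def by (intro exI[of _ e]) (auto intro: le_less_trans)
  qed
  then show ?thesis
    unfolding borel_segs_def by (rule borel_measurable_continuous_on_restrict)
qed

lemma test_function_bound: "G \<in> test_functions \<tau> \<Longrightarrow> \<phi> \<in> segs \<tau> \<Longrightarrow> \<bar>G \<phi>\<bar> \<le> 1"
  by (simp add: test_functions_def)

lemma integrable_test_function:
  assumes "G \<in> test_functions \<tau>" "prob_space P" "sets P = sets (borel_segs \<tau>)"
  shows "integrable P G" and "\<bar>\<integral>\<phi>. G \<phi> \<partial>P\<bar> \<le> 1"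
proof -
  interpret prob_space P by fact
  have s: "space P = segs \<tau>"
    using sets_eq_imp_space_eq[OF assms(3)] by simp
  have m: "G \<in> borel_measurable P"
    using test_function_measurable[OF assms(1)] by (simp add: measurable_cong_sets[OF assms(3) refl])
  show i: "integrable P G"
    by (rule integrable_const_bound[where B = 1])
       (use m s test_function_bound[OF assms(1)] in auto)
  have "\<bar>\<integral>\<phi>. G \<phi> \<partial>P\<bar> \<le> (\<integral>\<phi>. \<bar>G \<phi>\<bar> \<partial>P)"
    by (rule integral_abs_bound)
  also have "\<dots> \<le> (\<integral>\<phi>. 1 \<partial>P)"
    by (rule integral_mono) (use i s test_function_bound[OF assms(1)] in auto)
  finally show "\<bar>\<integral>\<phi>. G \<phi> \<partial>P\<bar> \<le> 1" by (simp add: prob_space)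
qed

lemma integral_diff_le_dist_L:
  fixes G :: "(real \<Rightarrow>\<^sub>C 'a::real_normed_vector) \<Rightarrow> real"
  assumes "G \<in> test_functions \<tau>"
    and "prob_space P" "sets P = sets (borel_segs \<tau>)"
    and "prob_space Q" "sets Q = sets (borel_segs \<tau>)"
  shows "\<bar>(\<integral>\<phi>. G \<phi> \<partial>P) - (\<integral>\<phi>. G \<phi> \<partial>Q)\<bar> \<le> dist_L \<tau> P Q"
  unfolding dist_L_def
\<comment> \<open>A supremum of reals dominates its members only if the family is bounded above; 2
  works since each integral is at most 1 in absolute value.\<close>
proof (rule cSUP_upper[OF assms(1)], rule bdd_aboveI2)
  fix G :: "(real \<Rightarrow>\<^sub>C 'a) \<Rightarrow> real" assume "G \<in> test_functions \<tau>"
  from integrable_test_function(2)[OF this assms(2,3)] integrable_test_function(2)[OF this assms(4,5)]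
  show "\<bar>(\<integral>\<phi>. G \<phi> \<partial>P) - (\<integral>\<phi>. G \<phi> \<partial>Q)\<bar> \<le> 2" by linarith
qed

lemma dist_L_le:
  assumes "\<And>G. G \<in> test_functions \<tau> \<Longrightarrow> \<bar>(\<integral>\<phi>. G \<phi> \<partial>P) - (\<integral>\<phi>. G \<phi> \<partial>Q)\<bar> \<le> e"
  shows "dist_L \<tau> P Q \<le> e"
proof -
  \<comment> \<open>The supremum must run over a nonempty set.\<close>
  have "(\<lambda>_. 0) \<in> test_functions \<tau>" by (simp add: test_functions_def)
  then show ?thesis unfolding dist_L_def using assms by (intro cSUP_least) auto
qed

text \<open>A pointwise form of Markov's inequality: up to distance \<open>d\<close> the Lipschitz
  bound applies, and beyond it the trivial bound 2 is at most twice the \<open>p\<close>-th power of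
  the distance divided by \<open>d\<close>. This turns \<open>p\<close>-th moments into bounds on
  \<open>dist_L\<close>, again for every \<open>p > 0\<close>.\<close>

lemma test_function_diff_le:
  assumes "G \<in> test_functions \<tau>" "\<phi> \<in> segs \<tau>" "\<psi> \<in> segs \<tau>" "0 < d" "0 < p"
  shows "\<bar>G \<phi> - G \<psi>\<bar> \<le> d + 2 * d powr (-p) * norm (\<phi> - \<psi>) powr p"
proof (cases "norm (\<phi> - \<psi>) \<le> d")
  case True
  have "0 \<le> 2 * d powr (-p) * norm (\<phi> - \<psi>) powr p" by simp
  moreover have "\<bar>G \<phi> - G \<psi>\<bar> \<le> norm (\<phi> - \<psi>)"
    using assms by (simp add: test_functions_def)
  ultimately show ?thesis using True by linarith
next
  case False
  then have "d powr p \<le> norm (\<phi> - \<psi>) powr p"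
    using assms by (intro powr_mono2) auto
  then have "d powr (-p) * d powr p \<le> d powr (-p) * norm (\<phi> - \<psi>) powr p"
    by (rule mult_left_mono) simp
  moreover have "d powr (-p) * d powr p = 1"
    using assms by (simp flip: powr_add)
  ultimately show ?thesis
    using test_function_bound[OF assms(1,2)] test_function_bound[OF assms(1,3)] assms(4) by linarith
qed

lemma moment_finite_integral:
  assumes "(\<lambda>\<omega>. norm (Y \<omega>)) \<in> borel_measurable M" "moment M p Y \<le> ennreal c" "0 \<le> c"
  shows "integrable M (\<lambda>\<omega>. norm (Y \<omega>) powr p)" "(\<integral>\<omega>. norm (Y \<omega>) powr p \<partial>M) \<le> c"
proof -
  note [measurable] = assms(1)
  have "(\<integral>\<^sup>+\<omega>. ennreal (norm (Y \<omega>) powr p) \<partial>M) < \<infinity>"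
    using le_less_trans[OF assms(2) ennreal_less_top] by (simp add: moment_def)
  then show i: "integrable M (\<lambda>\<omega>. norm (Y \<omega>) powr p)"
    by (intro integrableI_nonneg) auto
  then have "ennreal (\<integral>\<omega>. norm (Y \<omega>) powr p \<partial>M) = moment M p Y"
    unfolding moment_def by (subst nn_integral_eq_integral) auto
  then show "(\<integral>\<omega>. norm (Y \<omega>) powr p \<partial>M) \<le> c"
    using assms(2) by (simp flip: ennreal_le_iff[OF assms(3)])
qed

text \<open>Both variables live on one probability space, which serves as a coupling of their laws.
  The threshold \<open>d\<close> stays free: it is fixed first, and only then is the moment made
  small.\<close>

lemma expectation_diff_le:
  fixes Y Z :: "'w \<Rightarrow> (real \<Rightarrow>\<^sub>C 'a::{real_normed_vector, second_countable_topology})"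
  assumes "prob_space M" and G: "G \<in> test_functions \<tau>"
    and Y: "Y \<in> M \<rightarrow>\<^sub>M borel_segs \<tau>" and Z: "Z \<in> M \<rightarrow>\<^sub>M borel_segs \<tau>"
    and "0 < d" "0 < p" and c: "moment M p (\<lambda>\<omega>. Y \<omega> - Z \<omega>) \<le> ennreal c" "0 \<le> c"
  shows "\<bar>(\<integral>\<phi>. G \<phi> \<partial>distr M (borel_segs \<tau>) Y) - (\<integral>\<phi>. G \<phi> \<partial>distr M (borel_segs \<tau>) Z)\<bar>
    \<le> d + 2 * d powr (-p) * c"
proof -
  interpret prob_space M by fact
  note Gm = test_function_measurable[OF G]
  have int: "integrable M (\<lambda>\<omega>. G (V \<omega>))" if V: "V \<in> M \<rightarrow>\<^sub>M borel_segs \<tau>" for V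
    by (rule integrable_const_bound[where B = 1])
       (use measurable_compose[OF V Gm] test_function_bound[OF G] measurable_segs_into[OF V] in auto)
  note mom = moment_finite_integral[OF borel_measurable_norm_segs_diff[OF Y Z] c]
  have "\<bar>(\<integral>\<omega>. G (Y \<omega>) \<partial>M) - (\<integral>\<omega>. G (Z \<omega>) \<partial>M)\<bar> = \<bar>\<integral>\<omega>. G (Y \<omega>) - G (Z \<omega>) \<partial>M\<bar>"
    by (simp add: int Y Z)
  also have "\<dots> \<le> (\<integral>\<omega>. \<bar>G (Y \<omega>) - G (Z \<omega>)\<bar> \<partial>M)"
    by (rule integral_abs_bound)
  also have "\<dots> \<le> (\<integral>\<omega>. d + 2 * d powr (-p) * norm (Y \<omega> - Z \<omega>) powr p \<partial>M)"
    by (rule integral_mono)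
       (use mom(1) int[OF Y] int[OF Z] in \<open>auto intro!: test_function_diff_le[OF G]
          measurable_segs_into[OF Y] measurable_segs_into[OF Z] assms(5,6)\<close>)
  also have "\<dots> = d + 2 * d powr (-p) * (\<integral>\<omega>. norm (Y \<omega> - Z \<omega>) powr p \<partial>M)"
    using mom(1) by (simp add: prob_space)
  also have "\<dots> \<le> d + 2 * d powr (-p) * c"
    by (intro add_left_mono mult_left_mono mom(2)) auto
  finally show ?thesis
    by (simp add: integral_distr Y Z Gm)
qed

section \<open>The Markov property and averages of transition kernels\<close>

lemma homogeneous_markov_integral:
  fixes G :: "'s \<Rightarrow> real"
  assumes "prob_space M" and sub: "subalgebra M (F u)"
    and mk: "homogeneous_markov M F S I Z P" and uv: "u \<in> I" "v \<in> I" "u \<le> v"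
    and Zv: "Z v \<in> M \<rightarrow>\<^sub>M S"
    and G: "G \<in> borel_measurable S" "\<And>y. y \<in> space S \<Longrightarrow> \<bar>G y\<bar> \<le> B"
  shows "(\<integral>y. G y \<partial>distr M S (Z v)) = (\<integral>\<omega>. (\<integral>y. G y \<partial>P (v - u) (Z u \<omega>)) \<partial>M)"
proof -
  interpret prob_space M by fact
  interpret finite_measure_subalgebra M "F u"
    by unfold_locales (rule sub)
  have Zu: "Z u \<in> M \<rightarrow>\<^sub>M S"
    using mk uv(1) measurable_from_subalg[OF sub] by (auto simp: homogeneous_markov_def)
  have P: "P (v - u) \<in> S \<rightarrow>\<^sub>M prob_algebra S"
    using mk uv by (auto simp: homogeneous_markov_def)
  have PZ: "(\<lambda>\<omega>. P (v - u) (Z u \<omega>)) \<in> M \<rightarrow>\<^sub>M prob_algebra S"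
    by (rule measurable_compose[OF Zu P])
  have PZ': "(\<lambda>\<omega>. P (v - u) (Z u \<omega>)) \<in> M \<rightarrow>\<^sub>M subprob_algebra S"
    by (rule measurable_prob_algebraD[OF PZ])
  \<comment> \<open>\<open>homogeneous_markov\<close> speaks of indicators only, so the identity is
    first proved for laws, event by event, and then carried over to bounded integrands by
    \<open>integral_bind\<close>.\<close>
  have law: "distr M S (Z v) = M \<bind> (\<lambda>\<omega>. P (v - u) (Z u \<omega>))"
  proof (rule measure_eqI)
    show "sets (distr M S (Z v)) = sets (M \<bind> (\<lambda>\<omega>. P (v - u) (Z u \<omega>)))"
      by (simp add: sets_bind_measurable[OF PZ' not_empty])
  next
    fix A assume "A \<in> sets (distr M S (Z v))"
    then have A: "A \<in> sets S" by simp
    have ind: "(\<lambda>\<omega>. indicator A (Z v \<omega>) :: real) \<in> borel_measurable M"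
      using Zv A by measurable
    have iint: "integrable M (\<lambda>\<omega>. indicator A (Z v \<omega>) :: real)"
      by (rule integrable_const_bound[where B = 1]) (use ind in \<open>auto simp: indicator_def\<close>)
    have "measure (distr M S (Z v)) A = (\<integral>y. indicator A y \<partial>distr M S (Z v))"
      using A by simp
    also have "\<dots> = (\<integral>\<omega>. indicator A (Z v \<omega>) \<partial>M)"
      using A by (intro integral_distr Zv) auto
    also have "\<dots> = (\<integral>\<omega>. real_cond_exp M (F u) (\<lambda>\<omega>'. indicator A (Z v \<omega>')) \<omega> \<partial>M)"
      by (rule real_cond_exp_int(2)[symmetric, OF iint])
    also have "\<dots> = (\<integral>\<omega>. measure (P (v - u) (Z u \<omega>)) A \<partial>M)"
    proof (rule integral_cong_AE)
      show "AE \<omega> in M. real_cond_exp M (F u) (\<lambda>\<omega>'. indicator A (Z v \<omega>')) \<omega> = measure (P (v - u) (Z u \<omega>)) A"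
        using mk uv A unfolding homogeneous_markov_def by blast
      show "(\<lambda>\<omega>. measure (P (v - u) (Z u \<omega>)) A) \<in> borel_measurable M"
        by (rule measurable_compose[OF PZ measurable_measure_prob_algebra[OF A]])
    qed simp
    also have "\<dots> = measure (M \<bind> (\<lambda>\<omega>. P (v - u) (Z u \<omega>))) A"
      by (rule measure_bind[symmetric, OF PZ' A])
    finally have "measure (distr M S (Z v)) A = measure (M \<bind> (\<lambda>\<omega>. P (v - u) (Z u \<omega>))) A" .
    moreover have "prob_space (distr M S (Z v))" "prob_space (M \<bind> (\<lambda>\<omega>. P (v - u) (Z u \<omega>)))"
      using prob_space_distr[OF Zv] measurable_space[OF PZ]
      by (auto intro!: prob_space_bind[OF _ PZ'] simp: space_prob_algebra)
    ultimately show "emeasure (distr M S (Z v)) A = emeasure (M \<bind> (\<lambda>\<omega>. P (v - u) (Z u \<omega>))) A"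
      by (simp add: prob_space_def finite_measure.emeasure_eq_measure)
  qed
  show ?thesis
    unfolding law
  proof (rule integral_bind[OF G PZ'])
    show "AE \<omega> in M. emeasure (P (v - u) (Z u \<omega>)) (space (P (v - u) (Z u \<omega>))) \<le> ennreal 1"
      using measurable_space[OF PZ]
      by (auto simp: space_prob_algebra prob_space.emeasure_space_1 intro!: AE_I2)
  qed unfold_locales
qed

text \<open>The law \<open>Q 0\<close> is a fixed reference and can be moved under the integral over
  \<open>M\<close>. The pointwise bound then integrates to a moment of \<open>\<eta>\<close>, even
  if \<open>\<eta>\<close> does not stay in a compact set.\<close>

lemma kernel_average_diff_le:
  fixes G :: "(real \<Rightarrow>\<^sub>C 'a::{real_normed_vector, second_countable_topology}) \<Rightarrow> real"
    and \<eta> :: "'w \<Rightarrow> (real \<Rightarrow>\<^sub>C 'a)"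
  assumes "prob_space M" and G: "G \<in> test_functions \<tau>"
    and Q: "Q \<in> borel_segs \<tau> \<rightarrow>\<^sub>M prob_algebra (borel_segs \<tau>)"
    and \<eta>: "\<eta> \<in> M \<rightarrow>\<^sub>M borel_segs \<tau>" "moment M p \<eta> \<le> ennreal R" "0 \<le> R"
    and contr: "\<And>y. y \<in> segs \<tau> \<Longrightarrow>
      \<bar>(\<integral>\<phi>. G \<phi> \<partial>Q y) - (\<integral>\<phi>. G \<phi> \<partial>Q 0)\<bar> \<le> d + c * norm y powr p"
    and "0 \<le> c"
  shows "\<bar>(\<integral>\<omega>. (\<integral>\<phi>. G \<phi> \<partial>Q (\<eta> \<omega>)) \<partial>M) - (\<integral>\<phi>. G \<phi> \<partial>Q 0)\<bar> \<le> d + c * R"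
proof -
  interpret prob_space M by fact
  have Q\<eta>: "(\<lambda>\<omega>. Q (\<eta> \<omega>)) \<in> M \<rightarrow>\<^sub>M prob_algebra (borel_segs \<tau>)"
    by (rule measurable_compose[OF \<eta>(1) Q])
  have meas: "(\<lambda>\<omega>. \<integral>\<phi>. G \<phi> \<partial>Q (\<eta> \<omega>)) \<in> borel_measurable M"
    by (rule measurable_compose[OF measurable_prob_algebraD[OF Q\<eta>]
          integral_measurable_subprob_algebra[OF test_function_measurable[OF G]]])
  have int: "integrable M (\<lambda>\<omega>. \<integral>\<phi>. G \<phi> \<partial>Q (\<eta> \<omega>))"
  proof (rule integrable_const_bound[where B = 1])
    show "AE \<omega> in M. norm (\<integral>\<phi>. G \<phi> \<partial>Q (\<eta> \<omega>)) \<le> 1"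
      using measurable_space[OF Q\<eta>]
      by (auto simp: space_prob_algebra intro!: integrable_test_function(2)[OF G])
  qed (rule meas)
  note mom = moment_finite_integral[OF borel_measurable_norm_segs[OF \<eta>(1)] \<eta>(2,3)]
  have "\<bar>(\<integral>\<omega>. (\<integral>\<phi>. G \<phi> \<partial>Q (\<eta> \<omega>)) \<partial>M) - (\<integral>\<phi>. G \<phi> \<partial>Q 0)\<bar>
    = \<bar>\<integral>\<omega>. (\<integral>\<phi>. G \<phi> \<partial>Q (\<eta> \<omega>)) - (\<integral>\<phi>. G \<phi> \<partial>Q 0) \<partial>M\<bar>"
    using int by (simp add: prob_space)
  also have "\<dots> \<le> (\<integral>\<omega>. \<bar>(\<integral>\<phi>. G \<phi> \<partial>Q (\<eta> \<omega>)) - (\<integral>\<phi>. G \<phi> \<partial>Q 0)\<bar> \<partial>M)"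
    by (rule integral_abs_bound)
  also have "\<dots> \<le> (\<integral>\<omega>. d + c * norm (\<eta> \<omega>) powr p \<partial>M)"
    by (rule integral_mono) (use int mom(1) in \<open>auto intro!: contr measurable_segs_into[OF \<eta>(1)]\<close>)
  also have "\<dots> = d + c * (\<integral>\<omega>. norm (\<eta> \<omega>) powr p \<partial>M)"
    using mom(1) by (simp add: prob_space)
  also have "\<dots> \<le> d + c * R"
    by (intro add_left_mono mult_left_mono mom(2)) fact
  finally show ?thesis .
qed

section \<open>Segments on the grid and the flow of the numerical solution\<close>

lemma segment_cong:
  assumes "0 < \<tau>" and "\<And>u. t - \<tau> \<le> u \<Longrightarrow> u \<le> t \<Longrightarrow> z u \<omega> = z' u \<omega>"
  shows "segment \<tau> z t \<omega> = segment \<tau> z' t \<omega>"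
proof -
  have "z (t + clamp (-\<tau>) 0 r) \<omega> = z' (t + clamp (-\<tau>) 0 r) \<omega>" for r
    using clamp_in_real_interval[OF assms(1), of r] by (intro assms(2)) auto
  then show ?thesis by (simp add: segment_def ext_cont_def)
qed

text \<open>Membership in \<open>segs \<tau>\<close> determines \<open>y\<close> outside the delay
  interval, so agreement on that interval gives equality of the whole functions.\<close>

lemma segment_initial:
  assumes "0 < \<tau>" and "y \<in> segs \<tau>" and "\<forall>\<theta>\<in>{-\<tau>..0}. z (s + \<theta>) \<omega> = apply_bcontfun y \<theta>"
  shows "segment \<tau> z s \<omega> = y"
proof -
  have "z (s + clamp (-\<tau>) 0 r) \<omega> = apply_bcontfun y (clamp (-\<tau>) 0 r)" for r
    using clamp_in_real_interval[OF assms(1), of r] assms(3) by auto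
  then have "ext_cont (\<lambda>\<theta>. z (s + \<theta>) \<omega>) (-\<tau>) 0 = apply_bcontfun y"
    using assms(2) by (simp add: segs_def ext_cont_def)
  then show ?thesis by (simp add: segment_def apply_bcontfun_inverse)
qed

lemma zero_in_grid: "0 \<in> grid \<Delta>"
  unfolding grid_def by (auto intro: exI[of _ 0])

lemma of_nat_mult_in_grid: "real k * \<Delta> \<in> grid \<Delta>"
  unfolding grid_def by (auto intro: exI[of _ "int k"])

lemma grid_add: "a \<in> grid \<Delta> \<Longrightarrow> b \<in> grid \<Delta> \<Longrightarrow> a + b \<in> grid \<Delta>"
  unfolding grid_def by (auto simp flip: distrib_right of_int_add)

lemma grid_diff: "a \<in> grid \<Delta> \<Longrightarrow> b \<in> grid \<Delta> \<Longrightarrow> a - b \<in> grid \<Delta>"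
  unfolding grid_def by (auto simp flip: left_diff_distrib of_int_diff)

lemma delay_multiple_in_grid:
  assumes "\<Delta> \<in> step_sizes \<tau>" shows "real N * \<tau> \<in> grid \<Delta>"
proof -
  obtain n where n: "\<Delta> = \<tau> / real n" "0 < n"
    using assms by (auto simp: step_sizes_def)
  then have "real N * \<tau> = real (N * n) * \<Delta>" by simp
  then show ?thesis by (metis of_nat_mult_in_grid)
qed

lemma step_size_pos: "0 < \<tau> \<Longrightarrow> \<Delta> \<in> step_sizes \<tau> \<Longrightarrow> 0 < \<Delta>"
  by (auto simp: step_sizes_def)

lemma numerical_solution_initial:
  assumes "numerical_solution M F \<tau> \<Delta> X" "0 < \<tau>" "s \<in> grid \<Delta>" "0 \<le> s"
    "\<eta> \<in> F s \<rightarrow>\<^sub>M borel_segs \<tau>" "\<omega> \<in> space M" "\<eta> \<omega> \<in> segs \<tau>"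
  shows "segment \<tau> (X s \<eta>) s \<omega> = \<eta> \<omega>"
  using assms by (intro segment_initial) (auto simp: numerical_solution_def)

text \<open>The flow property gives equality only after \<open>T\<close>, while the segment at
  \<open>t\<close> may reach back before \<open>T\<close>. There the restarted solution repeats its
  initial segment, which was cut from the original path.\<close>

lemma numerical_solution_flow:
  assumes X: "numerical_solution M F \<tau> \<Delta> X" and "0 < \<tau>" and \<xi>: "\<xi> \<in> F 0 \<rightarrow>\<^sub>M borel_segs \<tau>"
    and T: "T \<in> grid \<Delta>" "0 \<le> T" "T \<le> t"
  shows "AE \<omega> in M. segment \<tau> (X 0 \<xi>) t \<omega> = segment \<tau> (X T (segment \<tau> (X 0 \<xi>) T)) t \<omega>"
proof -
  let ?\<eta> = "segment \<tau> (X 0 \<xi>) T"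
  have \<eta>: "?\<eta> \<in> F T \<rightarrow>\<^sub>M borel_segs \<tau>"
    using X \<xi> T zero_in_grid unfolding numerical_solution_def by blast
  have "AE \<omega> in M. \<forall>t>T. X 0 \<xi> t \<omega> = X T ?\<eta> t \<omega>"
    using X \<xi> T unfolding numerical_solution_def by blast
  then show ?thesis
  proof (rule AE_mp, intro AE_I2 impI)
    fix \<omega> assume \<omega>: "\<omega> \<in> space M" and flow: "\<forall>t>T. X 0 \<xi> t \<omega> = X T ?\<eta> t \<omega>"
    show "segment \<tau> (X 0 \<xi>) t \<omega> = segment \<tau> (X T ?\<eta>) t \<omega>"
    proof (rule segment_cong[OF \<open>0 < \<tau>\<close>])
      fix u assume u: "t - \<tau> \<le> u" "u \<le> t"
      show "X 0 \<xi> u \<omega> = X T ?\<eta> u \<omega>"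
      proof (cases "T < u")
        case False
        with u T have \<theta>: "u - T \<in> {-\<tau>..0}" by auto
        \<comment> \<open>The values of \<open>segment\<close> are those of the path only if the
          path is continuous on the window, since \<open>Bcontfun\<close> is inverted on bounded
          continuous functions only.\<close>
        have "continuous_on {0 - \<tau>..} (\<lambda>t. X 0 \<xi> t \<omega>)"
          using X \<xi> \<omega> zero_in_grid unfolding numerical_solution_def by blast
        then have c: "continuous_on {T - \<tau>..T} (\<lambda>t. X 0 \<xi> t \<omega>)"
          by (rule continuous_on_subset) (use T in auto)
        have "X T ?\<eta> (T + (u - T)) \<omega> = apply_bcontfun (?\<eta> \<omega>) (u - T)"
          using X \<eta> T \<omega> \<theta> unfolding numerical_solution_def by blast
        also have "\<dots> = X 0 \<xi> u \<omega>"
          using \<theta> by (simp add: segment_apply(1)[where z = "X 0 \<xi>", OF \<open>0 < \<tau>\<close> c] ext_cont_def clamp_cancel_cbox)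
        finally show ?thesis by simp
      qed (use flow in simp)
    qed
  qed
qed

section \<open>Moment recursion over delay windows\<close>

lemma moment_cong_AE: "AE \<omega> in M. Y \<omega> = Z \<omega> \<Longrightarrow> moment M p Y = moment M p Z"
  unfolding moment_def by (rule nn_integral_cong_AE) auto

text \<open>The suprema of \<open>b\<close> over the windows \<open>[j h - \<tau>, j h]\<close> satisfy \<open>S (j + 1) \<le> S j / 2 + L\<close>.\<close>

lemma grid_moment_bound:
  fixes b :: "real \<Rightarrow> ennreal" and \<kappa> :: "real \<Rightarrow> real"
  assumes h: "h \<in> grid \<Delta>" "0 < \<tau>" "\<tau> \<le> h"
    and init: "\<And>u. u \<le> 0 \<Longrightarrow> b u \<le> ennreal m"
    and "0 \<le> m" "0 \<le> L"
    and \<kappa>: "\<And>s. 0 \<le> s \<Longrightarrow> \<kappa> s \<le> A" "\<And>s. h - \<tau> \<le> s \<Longrightarrow> \<kappa> s \<le> 1/4"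
    and step: "\<And>R T t. 0 \<le> R \<Longrightarrow> T \<in> grid \<Delta> \<Longrightarrow> 0 \<le> T \<Longrightarrow>
      (\<And>u. u \<in> grid \<Delta> \<Longrightarrow> T - \<tau> \<le> u \<Longrightarrow> u \<le> T \<Longrightarrow> b u \<le> ennreal R) \<Longrightarrow>
      t \<in> grid \<Delta> \<Longrightarrow> T \<le> t \<Longrightarrow> t \<le> T + h \<Longrightarrow> b t \<le> ennreal (\<kappa> (t - T) * R + L + R / 4)"
    and t: "t \<in> grid \<Delta>" "0 \<le> t"
  shows "b t \<le> ennreal (A * (m + 2 * L) + L + (m + 2 * L) / 4)"
proof -
  \<comment> \<open>The recursion preserves this bound, because
    \<open>R / 4 + L + R / 4 \<le> R\<close> as soon as \<open>2 * L \<le> R\<close>; the summand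
    \<open>m\<close> covers the initial window.\<close>
  define R where "R = m + 2 * L"
  have R: "0 \<le> R" "m \<le> R" "2 * L \<le> R"
    using \<open>0 \<le> m\<close> \<open>0 \<le> L\<close> by (auto simp: R_def)
  have jh: "real j * h \<in> grid \<Delta>" for j
    by (induction j) (auto simp: zero_in_grid distrib_right intro: grid_add h)
  have window: "b u \<le> ennreal R" if "u \<in> grid \<Delta>" "real j * h - \<tau> \<le> u" "u \<le> real j * h" for j u
    using that
  proof (induction j arbitrary: u)
    case 0
    then show ?case using init[of u] R by (auto intro: order_trans ennreal_leI)
  next
    case (Suc j)
    have "b u \<le> ennreal (\<kappa> (u - real j * h) * R + L + R / 4)"
      using Suc.prems h by (intro step R jh Suc.IH) (auto simp: distrib_right)
    \<comment> \<open>A point of the next window has lag at least \<open>h - \<tau>\<close> from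
      \<open>real j * h\<close>, where \<open>\<kappa>\<close> has already contracted.\<close>
    also have "\<kappa> (u - real j * h) * R \<le> 1/4 * R"
      using Suc.prems R by (intro mult_right_mono \<kappa>) (auto simp: distrib_right)
    then have "ennreal (\<kappa> (u - real j * h) * R + L + R / 4) \<le> ennreal R"
      using R by (intro ennreal_leI) linarith
    finally show ?case .
  qed
  \<comment> \<open>The lag from the last multiple of \<open>h\<close> up to \<open>t\<close> may be
    short, so only the crude bound \<open>A\<close> for \<open>\<kappa>\<close> is available
    here.\<close>
  define j where "j = nat \<lfloor>t / h\<rfloor>"
  have "real j \<le> t / h" "t / h < real j + 1"
    using t h by (auto simp: j_def)
  then have j: "real j * h \<le> t" "t \<le> real j * h + h"
    using h by (auto simp: field_simps)
  have "b t \<le> ennreal (\<kappa> (t - real j * h) * R + L + R / 4)"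
    using t h j window by (intro step R jh) auto
  also have "\<kappa> (t - real j * h) * R \<le> A * R"
    using j R by (intro mult_right_mono \<kappa>) auto
  then have "ennreal (\<kappa> (t - real j * h) * R + L + R / 4) \<le> ennreal (A * R + L + R / 4)"
    by (intro ennreal_leI) linarith
  finally show ?thesis by (simp add: R_def)
qed

section \<open>Choosing small steps and long lags\<close>

lemma powr_small:
  fixes a e q :: real
  assumes "0 \<le> a" "0 < e" "0 < q"
  obtains r where "0 < r" "\<And>s. 0 < s \<Longrightarrow> s < r \<Longrightarrow> a * s powr q \<le> e"
proof
  \<comment> \<open>The denominator \<open>a + 1\<close> admits \<open>a = 0\<close>.\<close>
  let ?r = "(e / (a + 1)) powr (1 / q)"
  show "0 < ?r" using assms by simp
  fix s assume s: "0 < s" "s < ?r"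
  have "s powr q \<le> ?r powr q"
    using s assms by (intro powr_mono2) auto
  also have "?r powr q = e / (a + 1)"
    using assms by (simp add: powr_powr)
  finally have "a * s powr q \<le> a * (e / (a + 1))"
    using assms by (intro mult_left_mono)
  also have "\<dots> \<le> e"
    using assms by (simp add: field_simps)
  finally show "a * s powr q \<le> e" .
qed

lemma exp_decay_small:
  fixes a e c :: real
  assumes "0 < c" "0 < e"
  shows "\<forall>\<^sub>F s in at_top. a * exp (- c * s) \<le> e"
proof -
  have "((\<lambda>s. a * exp (- c * s)) \<longlongrightarrow> 0) at_top"
    using assms by real_asymp
  then have "\<forall>\<^sub>F s in at_top. a * exp (- c * s) < e"
    using assms(2) by (rule order_tendstoD)
  then show ?thesis by eventually_elim simp
qed

text \<open>The property is secured on the whole delay window that ends at the chosen lag, not just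
  at the lag itself; hence the witness \<open>Suc n\<close>.\<close>

lemma eventually_delay_multiple:
  assumes "\<forall>\<^sub>F s in at_top. P s" "0 < (\<tau>::real)"
  obtains N where "\<tau> \<le> real N * \<tau>" "\<And>s. real N * \<tau> - \<tau> \<le> s \<Longrightarrow> P s"
proof -
  obtain S where S: "\<And>s. S \<le> s \<Longrightarrow> P s"
    using assms(1) by (auto simp: eventually_at_top_linorder)
  obtain n where n: "S < real n * \<tau>"
    using ex_less_of_nat_mult[OF assms(2)] by blast
  have "P s" if "real (Suc n) * \<tau> - \<tau> \<le> s" for s
    using that n by (intro S) (simp add: distrib_right)
  then show ?thesis
    using assms(2) by (intro that[of "Suc n"]) (simp_all add: distrib_right)
qed

section \<open>Convergence of the numerical laws\<close>

theorem theorem3p7: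
  fixes M :: "'w measure"
    and F :: "real \<Rightarrow> 'w measure"
    and W :: "real \<Rightarrow> 'w \<Rightarrow> real^'m"
    and f :: "real^'d \<Rightarrow> real^'d \<Rightarrow> real^'d"
    and g :: "real^'d \<Rightarrow> real^'d \<Rightarrow> real^'m^'d"
    and x :: "real \<Rightarrow> ('w \<Rightarrow> (real \<Rightarrow>\<^sub>C (real^'d))) \<Rightarrow> real \<Rightarrow> 'w \<Rightarrow> real^'d"
    and X :: "real \<Rightarrow> real \<Rightarrow> ('w \<Rightarrow> (real \<Rightarrow>\<^sub>C (real^'d))) \<Rightarrow> real \<Rightarrow> 'w \<Rightarrow> real^'d"
    and \<pi> :: "(real \<Rightarrow>\<^sub>C (real^'d)) measure"
    and \<tau> p q K1 K2 K3 K4 K5 :: real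
    and Cst :: "real \<Rightarrow> real"
  assumes "0 < \<tau>" and "0 < p" and "0 < q"
    and "prob_space M" and "usual_filtration M F" and "brownian_motion M F W"
    and "(\<lambda>(a, b). f a b) \<in> borel_measurable borel"
    and "(\<lambda>(a, b). g a b) \<in> borel_measurable borel"
    and "unique_global_solution M F W \<tau> f g x"
    and markov: "\<And>s \<eta>. 0 \<le> s \<Longrightarrow> \<eta> \<in> F s \<rightarrow>\<^sub>M borel_segs \<tau> \<Longrightarrow>
      homogeneous_markov M F (borel_segs \<tau>) {s..} (segment \<tau> (x s \<eta>)) (segment_kernel M \<tau> (x 0))"
    and i_numerical: "\<And>\<Delta>. \<Delta> \<in> step_sizes \<tau> \<Longrightarrow> numerical_solution M F \<tau> \<Delta> (X \<Delta>)"
    and i_markov: "\<And>\<Delta> \<xi>. \<Delta> \<in> step_sizes \<tau> \<Longrightarrow> \<xi> \<in> F 0 \<rightarrow>\<^sub>M borel_segs \<tau> \<Longrightarrow>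
      homogeneous_markov M F (borel_segs \<tau>) (grid \<Delta> \<inter> {0..}) (segment \<tau> (X \<Delta> 0 \<xi>))
        (segment_kernel M \<tau> (X \<Delta> 0))"
    and "0 < K1" and "0 < K2" and "0 < K3"
    and ii: "\<And>s \<xi> t. 0 \<le> s \<Longrightarrow> \<xi> \<in> F s \<rightarrow>\<^sub>M borel_segs \<tau> \<Longrightarrow> 0 \<le> t \<Longrightarrow>
      moment M p (segment \<tau> (x s \<xi>) (s + t))
        \<le> ennreal K1 * moment M p \<xi> * ennreal (exp (- K2 * t)) + ennreal K3"
    and "0 < K4" and "0 < K5"
    and iii: "\<And>s K \<xi> \<eta> t. 0 \<le> s \<Longrightarrow> compact K \<Longrightarrow> K \<subseteq> segs \<tau> \<Longrightarrow>
      \<xi> \<in> F s \<rightarrow>\<^sub>M borel_segs \<tau> \<Longrightarrow> \<eta> \<in> F s \<rightarrow>\<^sub>M borel_segs \<tau> \<Longrightarrow>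
      (\<And>\<omega>. \<omega> \<in> space M \<Longrightarrow> \<xi> \<omega> \<in> K) \<Longrightarrow> (\<And>\<omega>. \<omega> \<in> space M \<Longrightarrow> \<eta> \<omega> \<in> K) \<Longrightarrow> 0 \<le> t \<Longrightarrow>
      moment M p (\<lambda>\<omega>. segment \<tau> (x s \<xi>) (s + t) \<omega> - segment \<tau> (x s \<eta>) (s + t) \<omega>)
        \<le> ennreal K4 * moment M p (\<lambda>\<omega>. \<xi> \<omega> - \<eta> \<omega>) * ennreal (exp (- K5 * t))"
    and iv: "\<And>\<Delta> \<xi> T1 T2. \<Delta> \<in> step_sizes \<tau> \<Longrightarrow> \<xi> \<in> F 0 \<rightarrow>\<^sub>M borel_segs \<tau> \<Longrightarrow>
      T1 \<in> grid \<Delta> \<Longrightarrow> T2 \<in> grid \<Delta> \<Longrightarrow> 0 \<le> T1 \<Longrightarrow> T1 < T2 \<Longrightarrow>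
      (SUP t \<in> grid \<Delta> \<inter> {T1..T2}.
         moment M p (\<lambda>\<omega>. segment \<tau> (x T1 (segment \<tau> (X \<Delta> 0 \<xi>) T1)) t \<omega>
                        - segment \<tau> (X \<Delta> T1 (segment \<tau> (X \<Delta> 0 \<xi>) T1)) t \<omega>))
        \<le> ennreal (Cst (T2 - T1))
           * (1 + (SUP t \<in> grid \<Delta> \<inter> {T1 - \<tau>..T1}.
                     if t \<le> 0 then moment M p \<xi> else moment M p (segment \<tau> (X \<Delta> 0 \<xi>) t)))
           * ennreal (\<Delta> powr q)"
    and "invariant_measure M \<tau> (x 0) \<pi>"
  shows "\<forall>\<xi> \<in> F 0 \<rightarrow>\<^sub>M borel_segs \<tau>. (\<exists>B. \<forall>\<omega>\<in>space M. norm (\<xi> \<omega>) \<le> B) \<longrightarrow>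
    (\<forall>\<epsilon>>0. \<exists>T>0. \<exists>\<Delta>\<^sub>0>0. \<forall>\<Delta>\<in>step_sizes \<tau>. \<Delta> < \<Delta>\<^sub>0 \<longrightarrow>
       (\<forall>k::nat. T \<le> real k * \<Delta> \<longrightarrow>
          dist_L \<tau> (segment_law M \<tau> (X \<Delta> 0) \<xi> (real k * \<Delta>)) \<pi> \<le> \<epsilon>))"
proof (intro ballI impI allI)
  fix \<xi> :: "'w \<Rightarrow> (real \<Rightarrow>\<^sub>C (real^'d))" and \<epsilon> :: real
  assume \<xi>: "\<xi> \<in> F 0 \<rightarrow>\<^sub>M borel_segs \<tau>" and "\<exists>B. \<forall>\<omega>\<in>space M. norm (\<xi> \<omega>) \<le> B" and "0 < \<epsilon>"
  then obtain B0 where B0: "\<And>\<omega>. \<omega> \<in> space M \<Longrightarrow> norm (\<xi> \<omega>) \<le> B0" by blast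
  note \<tau> = \<open>0 < \<tau>\<close> and p = \<open>0 < p\<close> and q = \<open>0 < q\<close>
  interpret prob_space M by fact
  have sub: "subalgebra M (F t)" if "0 \<le> t" for t
    using \<open>usual_filtration M F\<close> that by (simp add: usual_filtration_def)
  note from_F = measurable_from_subalg[OF sub]
  define P where "P = segment_kernel M \<tau> (x 0)"

  have X_meas: "segment \<tau> (X \<Delta> s \<eta>) t \<in> F t \<rightarrow>\<^sub>M borel_segs \<tau>"
    if "\<Delta> \<in> step_sizes \<tau>" "s \<in> grid \<Delta>" "0 \<le> s" "\<eta> \<in> F s \<rightarrow>\<^sub>M borel_segs \<tau>" "t \<in> grid \<Delta>" "s \<le> t"
    for \<Delta> s \<eta> t
    using i_numerical[OF that(1)] that unfolding numerical_solution_def by blast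
  have x_meas: "segment \<tau> (x s \<eta>) t \<in> M \<rightarrow>\<^sub>M borel_segs \<tau>"
    if "0 \<le> s" "\<eta> \<in> F s \<rightarrow>\<^sub>M borel_segs \<tau>" "s \<le> t" for s \<eta> t
    using markov[OF that(1,2)] that by (intro from_F[of t]) (auto simp: homogeneous_markov_def)
  have x_initial: "segment \<tau> (x s \<eta>) s \<omega> = \<eta> \<omega>"
    if "0 \<le> s" "\<eta> \<in> F s \<rightarrow>\<^sub>M borel_segs \<tau>" "\<omega> \<in> space M" for s \<eta> \<omega>
  proof (rule segment_initial[OF \<tau>])
    show "\<eta> \<omega> \<in> segs \<tau>"
      using measurable_segs_into[OF from_F] that by blast
    show "\<forall>\<theta>\<in>{-\<tau>..0}. x s \<eta> (s + \<theta>) \<omega> = apply_bcontfun (\<eta> \<omega>) \<theta>"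
      using \<open>unique_global_solution M F W \<tau> f g x\<close> that
      unfolding unique_global_solution_def solves_sdde_def by blast
  qed

  \<comment> \<open>Moment bound uniform in time and step size\<close>
  have moment_\<xi>: "moment M p \<xi> \<le> ennreal (\<bar>B0\<bar> powr p)"
  proof -
    have "norm (\<xi> \<omega>) powr p \<le> \<bar>B0\<bar> powr p" if "\<omega> \<in> space M" for \<omega>
      using B0[OF that] p by (intro powr_mono2) auto
    then have "moment M p \<xi> \<le> (\<integral>\<^sup>+\<omega>. ennreal (\<bar>B0\<bar> powr p) \<partial>M)"
      unfolding moment_def by (intro nn_integral_mono ennreal_leI)
    then show ?thesis by (simp add: emeasure_space_1)
  qed

  \<comment> \<open>This follows the convention in (iv) for nonpositive times. At time 0 it agrees
    with the numerical moment, since the segment there is \<open>\<xi>\<close> itself.\<close>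
  define b where "b \<Delta> u = (if u \<le> 0 then moment M p \<xi> else moment M p (segment \<tau> (X \<Delta> 0 \<xi>) u))" for \<Delta> u
  have b_eq: "moment M p (segment \<tau> (X \<Delta> 0 \<xi>) t) = b \<Delta> t" if "\<Delta> \<in> step_sizes \<tau>" "0 \<le> t" for \<Delta> t
  proof (cases "t = 0")
    case True
    have "AE \<omega> in M. segment \<tau> (X \<Delta> 0 \<xi>) t \<omega> = \<xi> \<omega>"
      using numerical_solution_initial[OF i_numerical[OF that(1)] \<tau> zero_in_grid _ \<xi>]
        measurable_segs_into[OF from_F[OF _ \<xi>]] True by (intro AE_I2) auto
    then show ?thesis using True by (simp add: b_def moment_cong_AE)
  qed (use that in \<open>simp add: b_def\<close>)

  \<comment> \<open>Condition (iv) involves the numerical solution restarted at \<open>T\<close>;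
    the flow property exchanges it for the original numerical path. The sign of \<open>Cst h\<close>
    is unknown, hence the maximum with 0.\<close>
  have local_error: "moment M p (\<lambda>\<omega>. segment \<tau> (x T (segment \<tau> (X \<Delta> 0 \<xi>) T)) t \<omega> - segment \<tau> (X \<Delta> 0 \<xi>) t \<omega>)
      \<le> ennreal (max 0 (Cst h) * (1 + R) * \<Delta> powr q)"
    if \<Delta>: "\<Delta> \<in> step_sizes \<tau>" and T: "T \<in> grid \<Delta>" "0 \<le> T" and h: "h \<in> grid \<Delta>" "0 < h"
      and t: "t \<in> grid \<Delta>" "T \<le> t" "t \<le> T + h" and "0 \<le> R"
      and R: "\<And>u. u \<in> grid \<Delta> \<Longrightarrow> T - \<tau> \<le> u \<Longrightarrow> u \<le> T \<Longrightarrow> b \<Delta> u \<le> ennreal R" for \<Delta> T h t R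
  proof -
    let ?\<eta> = "segment \<tau> (X \<Delta> 0 \<xi>) T"
    let ?D = "\<lambda>t. moment M p (\<lambda>\<omega>. segment \<tau> (x T ?\<eta>) t \<omega> - segment \<tau> (X \<Delta> T ?\<eta>) t \<omega>)"
    have "moment M p (\<lambda>\<omega>. segment \<tau> (x T ?\<eta>) t \<omega> - segment \<tau> (X \<Delta> 0 \<xi>) t \<omega>) = ?D t"
      using numerical_solution_flow[OF i_numerical[OF \<Delta>] \<tau> \<xi> T t(2)]
      by (intro moment_cong_AE) (auto elim: AE_mp)
    also have "?D t \<le> (SUP t \<in> grid \<Delta> \<inter> {T..T + h}. ?D t)"
      using t by (intro SUP_upper) auto
    also have "\<dots> \<le> ennreal (Cst (T + h - T)) * (1 + (SUP t \<in> grid \<Delta> \<inter> {T - \<tau>..T}. b \<Delta> t)) * ennreal (\<Delta> powr q)"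
      unfolding b_def using h by (intro iv[OF \<Delta> \<xi>] T grid_add) auto
    also have "\<dots> \<le> ennreal (max 0 (Cst h)) * (1 + ennreal R) * ennreal (\<Delta> powr q)"
      by (intro mult_mono add_mono SUP_least ennreal_leI) (auto intro: R)
    also have "\<dots> = ennreal (max 0 (Cst h) * (1 + R) * \<Delta> powr q)"
      using \<open>0 \<le> R\<close> by (simp add: ennreal_mult flip: ennreal_1 ennreal_plus del: ennreal_1)
    finally show ?thesis .
  qed

  text \<open>Time lags are multiples of \<open>\<tau>\<close>: these lie on every grid, so that a single value of \<open>Cst\<close>
    serves all step sizes.\<close>
  define A where "A = 2 powr p * K1"
  \<comment> \<open>The extra \<open>1 / 4\<close> absorbs the constant part of the numerical error
    \<open>1/4 * (1 + R)\<close>.\<close>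
  define L where "L = 2 powr p * K3 + 1 / 4"
  \<comment> \<open>The bound of \<open>grid_moment_bound\<close> with
    \<open>m = \<bar>B0\<bar> powr p\<close>, plus a last summand for times up to 0.\<close>
  define R where "R = A * (\<bar>B0\<bar> powr p + 2 * L) + L + (\<bar>B0\<bar> powr p + 2 * L) / 4 + \<bar>B0\<bar> powr p"
  have pos: "0 \<le> A" "0 \<le> L" "0 \<le> R"
    using \<open>0 < K1\<close> \<open>0 < K3\<close> by (auto simp: A_def L_def R_def)
  have "\<forall>\<^sub>F s in at_top. A * exp (- K2 * s) \<le> 1/4"
    using \<open>0 < K2\<close> by (intro exp_decay_small) auto
  from eventually_delay_multiple[OF this \<tau>] obtain N0 where
    N0: "\<tau> \<le> real N0 * \<tau>" "\<And>s. real N0 * \<tau> - \<tau> \<le> s \<Longrightarrow> A * exp (- K2 * s) \<le> 1/4" by blast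
  define h0 where "h0 = real N0 * \<tau>"
  \<comment> \<open>Below \<open>r0\<close> the error over lag \<open>h0\<close> is at most a
    quarter of one plus the window bound, whatever that bound is. The threshold is thus independent
    of the moments still to be controlled.\<close>
  obtain r0 where r0: "0 < r0" "\<And>s. 0 < s \<Longrightarrow> s < r0 \<Longrightarrow> (2 powr p * max 0 (Cst h0)) * s powr q \<le> 1/4"
    using powr_small[of "2 powr p * max 0 (Cst h0)" "1/4" q] q by auto
  have b_bound: "b \<Delta> t \<le> ennreal R"
    if \<Delta>: "\<Delta> \<in> step_sizes \<tau>" "\<Delta> < r0" and t: "t \<in> grid \<Delta>" for \<Delta> t
  proof (cases "t \<le> 0")
    case True
    have "\<bar>B0\<bar> powr p \<le> R"
      using pos by (simp add: R_def)
    then show ?thesis using True moment_\<xi> by (auto simp: b_def intro: order_trans ennreal_leI)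
  next
    case False
    have "b \<Delta> t \<le> ennreal (A * (\<bar>B0\<bar> powr p + 2 * L) + L + (\<bar>B0\<bar> powr p + 2 * L) / 4)"
    proof (rule grid_moment_bound[where \<kappa> = "\<lambda>s. A * exp (- K2 * s)" and b = "b \<Delta>"])
      show "h0 \<in> grid \<Delta>" "\<tau> \<le> h0"
        using N0 delay_multiple_in_grid[OF \<Delta>(1)] by (auto simp: h0_def)
      show "b \<Delta> u \<le> ennreal (\<bar>B0\<bar> powr p)" if "u \<le> 0" for u
        using that moment_\<xi> by (simp add: b_def)
      show "A * exp (- K2 * s) \<le> A" if "0 \<le> s" for s
        using that pos \<open>0 < K2\<close> by (intro mult_left_le) auto
      show "A * exp (- K2 * s) \<le> 1/4" if "h0 - \<tau> \<le> s" for s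
        using N0 that by (simp add: h0_def)
    next
      \<comment> \<open>This \<open>R\<close> is an arbitrary window bound, not the constant defined
        above.\<close>
      fix R T t
      assume R: "0 \<le> R" and T: "T \<in> grid \<Delta>" "0 \<le> T"
        and window: "\<And>u. u \<in> grid \<Delta> \<Longrightarrow> T - \<tau> \<le> u \<Longrightarrow> u \<le> T \<Longrightarrow> b \<Delta> u \<le> ennreal R"
        and t: "t \<in> grid \<Delta>" "T \<le> t" "t \<le> T + h0"
      let ?\<eta> = "segment \<tau> (X \<Delta> 0 \<xi>) T"
      let ?E = "max 0 (Cst h0) * (1 + R) * \<Delta> powr q"
      have \<eta>: "?\<eta> \<in> F T \<rightarrow>\<^sub>M borel_segs \<tau>"
        using X_meas[OF \<Delta>(1) zero_in_grid _ \<xi> T(1)] T by simp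
      have h0: "h0 \<in> grid \<Delta>" "0 < h0"
        using N0 \<tau> delay_multiple_in_grid[OF \<Delta>(1)] by (auto simp: h0_def)
      have "moment M p (segment \<tau> (x T ?\<eta>) (T + (t - T)))
          \<le> ennreal K1 * moment M p ?\<eta> * ennreal (exp (- K2 * (t - T))) + ennreal K3"
        using T t by (intro ii \<eta>) auto
      also have "moment M p ?\<eta> = b \<Delta> T"
        by (rule b_eq[OF \<Delta>(1) T(2)])
      also have "ennreal K1 * b \<Delta> T * ennreal (exp (- K2 * (t - T))) + ennreal K3
          \<le> ennreal K1 * ennreal R * ennreal (exp (- K2 * (t - T))) + ennreal K3"
        using T \<tau> by (intro add_mono mult_mono window) auto
      also have "\<dots> = ennreal (K1 * R * exp (- K2 * (t - T)) + K3)"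
        using R \<open>0 < K1\<close> \<open>0 < K3\<close> by (simp add: ennreal_mult)
      finally have exact: "moment M p (segment \<tau> (x T ?\<eta>) t)
          \<le> ennreal (K1 * R * exp (- K2 * (t - T)) + K3)" by simp
      have "b \<Delta> t = moment M p (segment \<tau> (X \<Delta> 0 \<xi>) t)"
        using b_eq[OF \<Delta>(1)] T t by simp
      also have "\<dots> \<le> ennreal (2 powr p) * (moment M p (segment \<tau> (x T ?\<eta>) t)
          + moment M p (\<lambda>\<omega>. segment \<tau> (x T ?\<eta>) t \<omega> - segment \<tau> (X \<Delta> 0 \<xi>) t \<omega>))"
        using T t
        by (intro moment_triangle[OF x_meas[OF T(2) \<eta> t(2)]
              from_F[OF _ X_meas[OF \<Delta>(1) zero_in_grid _ \<xi>]] p]) auto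
      also have "\<dots> \<le> ennreal (2 powr p) * (ennreal (K1 * R * exp (- K2 * (t - T)) + K3) + ennreal ?E)"
        by (intro mult_left_mono add_mono exact local_error \<Delta> T h0 t R window) auto
      also have "\<dots> = ennreal (2 powr p * (K1 * R * exp (- K2 * (t - T)) + K3 + ?E))"
        using R \<open>0 < K1\<close> \<open>0 < K3\<close> by (simp add: ennreal_mult)
      also have "\<dots> \<le> ennreal (A * exp (- K2 * (t - T)) * R + L + R / 4)"
      proof (rule ennreal_leI)
        have "2 powr p * max 0 (Cst h0) * \<Delta> powr q * (1 + R) \<le> 1/4 * (1 + R)"
          using r0 step_size_pos[OF \<tau> \<Delta>(1)] \<Delta>(2) R by (intro mult_right_mono) auto
        then show "2 powr p * (K1 * R * exp (- K2 * (t - T)) + K3 + ?E)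
            \<le> A * exp (- K2 * (t - T)) * R + L + R / 4"
          by (simp add: A_def L_def algebra_simps)
      qed
      finally show "b \<Delta> t \<le> ennreal (A * exp (- K2 * (t - T)) * R + L + R / 4)" .
    qed (use pos \<tau> t False in auto)
    then show ?thesis
      by (rule order_trans) (simp add: R_def ennreal_leI)
  qed

  \<comment> \<open>Comparison with the invariant measure over one fixed lag\<close>
  define \<delta> where "\<delta> = \<epsilon> / 5"
  define c where "c = 2 * \<delta> powr (-p)"
  have \<delta>: "0 < \<delta>" and c: "0 \<le> c"
    using \<open>0 < \<epsilon>\<close> by (auto simp: \<delta>_def c_def)
  have "\<forall>\<^sub>F h in at_top. c * K4 * R * exp (- K5 * h) \<le> \<delta>"
    by (rule exp_decay_small) fact+
  moreover have "((\<lambda>h. dist_L \<tau> (P h 0) \<pi>) \<longlongrightarrow> 0) at_top"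
    using \<open>invariant_measure M \<tau> (x 0) \<pi>\<close> by (simp add: invariant_measure_def P_def zero_in_segs)
  from order_tendstoD(2)[OF this \<delta>] have "\<forall>\<^sub>F h in at_top. dist_L \<tau> (P h 0) \<pi> < \<delta>" .
  ultimately have "\<forall>\<^sub>F h in at_top. c * K4 * R * exp (- K5 * h) \<le> \<delta> \<and> dist_L \<tau> (P h 0) \<pi> < \<delta>"
    by (rule eventually_conj)
  from eventually_delay_multiple[OF this \<tau>] obtain N where N: "\<tau> \<le> real N * \<tau>"
    "\<And>s. real N * \<tau> - \<tau> \<le> s \<Longrightarrow> c * K4 * R * exp (- K5 * s) \<le> \<delta> \<and> dist_L \<tau> (P s 0) \<pi> < \<delta>" by blast
  define h where "h = real N * \<tau>"
  have h: "0 < h" "c * K4 * R * exp (- K5 * h) \<le> \<delta>" "dist_L \<tau> (P h 0) \<pi> < \<delta>"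
    using N(2)[of h] N(1) \<tau> by (auto simp: h_def)
  \<comment> \<open>The lag \<open>h\<close> was chosen from \<open>R\<close>, which does not depend
    on the step. With \<open>h\<close> fixed, \<open>Cst h\<close> is a constant and a small step
    beats it.\<close>
  obtain r where r: "0 < r" "\<And>s. 0 < s \<Longrightarrow> s < r \<Longrightarrow> (c * (max 0 (Cst h) * (1 + R))) * s powr q \<le> \<delta>"
    using powr_small[of "c * (max 0 (Cst h) * (1 + R))" \<delta> q] q \<delta> c pos by auto

  have const_meas: "(\<lambda>_. y) \<in> F s \<rightarrow>\<^sub>M borel_segs \<tau>" if "y \<in> segs \<tau>" for s and y :: "real \<Rightarrow>\<^sub>C (real^'d)"
    using that by simp
  have P_law: "prob_space (P h y)" "sets (P h y) = sets (borel_segs \<tau>)" if "y \<in> segs \<tau>" for y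
    using prob_space_distr[OF x_meas[OF order_refl const_meas[OF that]]] h(1)
    by (auto simp: P_def segment_kernel_def segment_law_def)
  have contraction: "\<bar>(\<integral>\<phi>. G \<phi> \<partial>P h y) - (\<integral>\<phi>. G \<phi> \<partial>P h 0)\<bar>
      \<le> \<delta> + (c * K4 * exp (- K5 * h)) * norm y powr p"
    if G: "G \<in> test_functions \<tau>" and y: "y \<in> segs \<tau>" for G y
  proof -
    have "moment M p (\<lambda>\<omega>. segment \<tau> (x 0 (\<lambda>_. y)) (0 + h) \<omega> - segment \<tau> (x 0 (\<lambda>_. 0)) (0 + h) \<omega>)
        \<le> ennreal K4 * moment M p (\<lambda>_. y - 0) * ennreal (exp (- K5 * h))"
      using y h by (intro iii[of 0 "{y, 0}"] const_meas zero_in_segs) (auto simp: zero_in_segs)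
    also have "\<dots> = ennreal (K4 * norm y powr p * exp (- K5 * h))"
      using \<open>0 < K4\<close> by (simp add: moment_def emeasure_space_1 ennreal_mult)
    finally have "moment M p (\<lambda>\<omega>. segment \<tau> (x 0 (\<lambda>_. y)) h \<omega> - segment \<tau> (x 0 (\<lambda>_. 0)) h \<omega>)
        \<le> ennreal (K4 * norm y powr p * exp (- K5 * h))" by simp
    then have "\<bar>(\<integral>\<phi>. G \<phi> \<partial>P h y) - (\<integral>\<phi>. G \<phi> \<partial>P h 0)\<bar>
        \<le> \<delta> + 2 * \<delta> powr (-p) * (K4 * norm y powr p * exp (- K5 * h))"
      unfolding P_def segment_kernel_def segment_law_def
      using h \<delta> p y \<open>0 < K4\<close> zero_in_segs
      by (intro expectation_diff_le[OF \<open>prob_space M\<close> G] x_meas const_meas) auto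
    then show ?thesis by (simp add: c_def mult_ac)
  qed

  have final: "dist_L \<tau> (segment_law M \<tau> (X \<Delta> 0) \<xi> t) \<pi> \<le> \<epsilon>"
    if \<Delta>: "\<Delta> \<in> step_sizes \<tau>" "\<Delta> < r0" "\<Delta> < r" and t: "t \<in> grid \<Delta>" "h \<le> t" for \<Delta> t
  proof (rule dist_L_le)
    fix G :: "(real \<Rightarrow>\<^sub>C (real^'d)) \<Rightarrow> real" assume G: "G \<in> test_functions \<tau>"
    define T where "T = t - h"
    have hg: "h \<in> grid \<Delta>"
      using delay_multiple_in_grid[OF \<Delta>(1)] by (simp add: h_def)
    have T: "T \<in> grid \<Delta>" "0 \<le> T" "T \<le> t" "t \<le> T + h" "t - T = h"
      using t h hg by (auto simp: T_def intro: grid_diff)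
    let ?\<eta> = "segment \<tau> (X \<Delta> 0 \<xi>) T"
    let ?lx = "distr M (borel_segs \<tau>) (segment \<tau> (x T ?\<eta>) t)"
    let ?lX = "distr M (borel_segs \<tau>) (segment \<tau> (X \<Delta> 0 \<xi>) t)"
    have \<eta>: "?\<eta> \<in> F T \<rightarrow>\<^sub>M borel_segs \<tau>"
      using X_meas[OF \<Delta>(1) zero_in_grid _ \<xi> T(1)] T by simp
    have \<eta>M: "?\<eta> \<in> M \<rightarrow>\<^sub>M borel_segs \<tau>"
      by (rule from_F[OF T(2) \<eta>])
    have XM: "segment \<tau> (X \<Delta> 0 \<xi>) t \<in> M \<rightarrow>\<^sub>M borel_segs \<tau>"
      using T t by (intro from_F[OF _ X_meas[OF \<Delta>(1) zero_in_grid _ \<xi>]]) auto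
    have xM: "segment \<tau> (x T ?\<eta>) t \<in> M \<rightarrow>\<^sub>M borel_segs \<tau>"
      by (rule x_meas[OF T(2) \<eta> T(3)])

    have "\<bar>(\<integral>\<phi>. G \<phi> \<partial>?lx) - (\<integral>\<phi>. G \<phi> \<partial>?lX)\<bar> \<le> \<delta> + 2 * \<delta> powr (-p) * (max 0 (Cst h) * (1 + R) * \<Delta> powr q)"
      using pos by (intro expectation_diff_le[OF \<open>prob_space M\<close> G xM XM \<delta> p]
          local_error \<Delta> T hg h t b_bound) auto
    moreover have "2 * \<delta> powr (-p) * (max 0 (Cst h) * (1 + R) * \<Delta> powr q) \<le> \<delta>"
      using r(2)[OF step_size_pos[OF \<tau> \<Delta>(1)] \<Delta>(3)] by (simp add: c_def mult_ac)
    ultimately have 1: "\<bar>(\<integral>\<phi>. G \<phi> \<partial>?lx) - (\<integral>\<phi>. G \<phi> \<partial>?lX)\<bar> \<le> 2 * \<delta>"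
      by linarith

    \<comment> \<open>Measurability in the initial state is part of the Markov hypothesis for the
      lag \<open>t - T = h\<close>.\<close>
    have Pm: "P h \<in> borel_segs \<tau> \<rightarrow>\<^sub>M prob_algebra (borel_segs \<tau>)"
      using markov[OF T(2) \<eta>] T unfolding homogeneous_markov_def P_def by fastforce
    \<comment> \<open>The Markov property is applied at the starting time \<open>T\<close> of the
      restarted solution, where its segment is the numerical segment.\<close>
    have "(\<integral>\<phi>. G \<phi> \<partial>?lx) = (\<integral>\<omega>. (\<integral>\<phi>. G \<phi> \<partial>segment_kernel M \<tau> (x 0) (t - T) (segment \<tau> (x T ?\<eta>) T \<omega>)) \<partial>M)"
      using T by (intro homogeneous_markov_integral[OF \<open>prob_space M\<close> sub[OF T(2)] markov[OF T(2) \<eta>]]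
          xM test_function_measurable[OF G]) (auto intro: test_function_bound[OF G])
    also have "\<dots> = (\<integral>\<omega>. (\<integral>\<phi>. G \<phi> \<partial>P h (?\<eta> \<omega>)) \<partial>M)"
      by (intro Bochner_Integration.integral_cong) (simp_all add: P_def T x_initial[OF T(2) \<eta>])
    finally have lx: "(\<integral>\<phi>. G \<phi> \<partial>?lx) = (\<integral>\<omega>. (\<integral>\<phi>. G \<phi> \<partial>P h (?\<eta> \<omega>)) \<partial>M)" .
    have "\<bar>(\<integral>\<phi>. G \<phi> \<partial>?lx) - (\<integral>\<phi>. G \<phi> \<partial>P h 0)\<bar> \<le> \<delta> + (c * K4 * exp (- K5 * h)) * R"
      unfolding lx
    proof (rule kernel_average_diff_le[OF \<open>prob_space M\<close> G Pm \<eta>M])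
      show "moment M p ?\<eta> \<le> ennreal R"
        using b_eq[OF \<Delta>(1) T(2)] b_bound[OF \<Delta>(1,2) T(1)] by simp
    qed (use contraction[OF G] pos c \<open>0 < K4\<close> in auto)
    then have 2: "\<bar>(\<integral>\<phi>. G \<phi> \<partial>?lx) - (\<integral>\<phi>. G \<phi> \<partial>P h 0)\<bar> \<le> 2 * \<delta>"
      using h(2) by (simp add: mult_ac)

    have "\<bar>(\<integral>\<phi>. G \<phi> \<partial>P h 0) - (\<integral>\<phi>. G \<phi> \<partial>\<pi>)\<bar> \<le> dist_L \<tau> (P h 0) \<pi>"
      using \<open>invariant_measure M \<tau> (x 0) \<pi>\<close> P_law[OF zero_in_segs]
      by (intro integral_diff_le_dist_L[OF G]) (auto simp: invariant_measure_def)
    \<comment> \<open>The three errors take two, two and one of the five shares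
      \<open>\<delta>\<close> of \<open>\<epsilon>\<close>.\<close>
    with 1 2 h(3) show "\<bar>(\<integral>\<phi>. G \<phi> \<partial>segment_law M \<tau> (X \<Delta> 0) \<xi> t) - (\<integral>\<phi>. G \<phi> \<partial>\<pi>)\<bar> \<le> \<epsilon>"
      unfolding segment_law_def \<delta>_def by linarith
  qed
  \<comment> \<open>The time threshold is \<open>h\<close>, so that the restart time
    \<open>t - h\<close> is nonnegative; \<open>r0\<close> secures the moments and \<open>r\<close>
    the error over the last lag.\<close>
  show "\<exists>T>0. \<exists>\<Delta>\<^sub>0>0. \<forall>\<Delta>\<in>step_sizes \<tau>. \<Delta> < \<Delta>\<^sub>0 \<longrightarrow>
       (\<forall>k::nat. T \<le> real k * \<Delta> \<longrightarrow>
          dist_L \<tau> (segment_law M \<tau> (X \<Delta> 0) \<xi> (real k * \<Delta>)) \<pi> \<le> \<epsilon>)"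
    using h(1) r(1) r0(1)
    by (intro exI[of _ h] exI[of _ "min r0 r"] conjI ballI impI allI final of_nat_mult_in_grid) auto
qed

end
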